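(* Let $A\in\operatorname{Mat}_{m\times n}(\mathbb{R})$ belong to the class $\mathcal{C}$. Then $\lambda_{\mathbb{T}^m}(\operatorname{Bad}_A)=0$, where $\lambda_{\mathbb{T}^m}$ is the Lebesgue probability measure on $\mathbb{T}^m$.
   Context: $d=m+n$. All norms are sup-norms $\|z\|=\max_i|z_i|$, and $\langle z\rangle=\min_{p\in\mathbb{Z}^m}\|z-p\|$. $\operatorname{Bad}_A=\{\eta\in\mathbb{T}^m:\liminf_{q\in\mathbb{Z}^n,\|q\|\to\infty}\|q\|^{n/m}\langle Aq-\eta\rangle>0\}$. Assume the columns of $A$ are linearly independent over $\mathbb{Q}$ and let $\Psi_A(t)=\min\{\langle Aq\rangle:q\in\mathbb{Z}^n,\ 0<\|q\|\le t\}$, a piecewise constant function decreasing to $0$. Let $M_1<M_2<\cdots$ be the sequence of all points where $\Psi_A$ is discontinuous, $\zeta_l=\Psi_A(M_l)$, and $\Delta_l=M_{l+1}^n\zeta_l^m$. The class $\mathcal{C}$ consists of those $A$ for which there is an increasing sequence of indices $(l_k)$ such that (1) $\sum_{k=1}^\infty\Delta_{l_k}^{d-1}=\infty$ and (2) $H_k:=\sup_{k_1\ge k+1}\left(\frac{\zeta_{l_{k_1}}}{\Delta_{l_{k_1}}}\right)^m\left(\frac{M_{l_k+1}}{\Delta_{l_k}}\right)^n\to0$ as $k\to\infty$ (here $M_{l_k+1}$ is $M_j$ with $j=l_k+1$). *)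

theory Defs
  imports "HOL-Probability.Probability"
begin

text \<open>A real m x n matrix is an element \<open>A :: real^'n^'m\<close>, with \<open>m = CARD('m)\<close> and
  \<open>n = CARD('n)\<close>. The sup-norm is the library's \<^const>\<open>infnorm\<close>.\<close>

definition int_vecs :: "(real^'k) set" where
  "int_vecs = {p. \<forall>i. p $ i \<in> \<int>}"

text \<open>The distance to the integer lattice; the infimum is attained
  (\<open>int_dist_attained\<close> below), so it is a minimum.\<close>

definition int_dist :: "real^'k \<Rightarrow> real" where
  "int_dist z = (INF p\<in>int_vecs. infnorm (z - p))"


subsection \<open>The torus and its Lebesgue probability measure\<close>

quotient_type 'k torus = "real^'k" / "\<lambda>x y. x - y \<in> int_vecs"
  morphisms rep_torus torus_of
proof (rule equivpI)
  show "reflp (\<lambda>x y::real^'k. x - y \<in> int_vecs)"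
    by (auto simp: reflp_def int_vecs_def)
  show "symp (\<lambda>x y::real^'k. x - y \<in> int_vecs)"
    unfolding symp_def int_vecs_def mem_Collect_eq vector_minus_component
    by (metis Ints_minus minus_diff_eq)
  show "transp (\<lambda>x y::real^'k. x - y \<in> int_vecs)"
    unfolding transp_def int_vecs_def mem_Collect_eq vector_minus_component
    by (metis Ints_add diff_add_cancel add_diff_eq)
qed

text \<open>The image of Lebesgue measure on the fundamental domain \<open>[0,1)^k\<close> under the quotient map;
  a set is measurable iff its preimage in \<open>real^'k\<close> is Lebesgue measurable.\<close>

definition torus_lebesgue :: "('k::finite) torus measure" where
  "torus_lebesgue =
     distr (restrict_space lebesgue {x :: real^'k. \<forall>i. 0 \<le> x $ i \<and> x $ i < 1})
       (sigma UNIV {B. torus_of -` B \<in> sets lebesgue}) torus_of"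

lemma int_dist_diff_int:
  assumes "p \<in> int_vecs"
  shows "int_dist (z - p) = int_dist (z :: real^'k)"
proof -
  have "(\<lambda>r. p + r) ` int_vecs = (int_vecs :: (real^'k) set)"
  proof
    show "(\<lambda>r. p + r) ` int_vecs \<subseteq> int_vecs"
      using assms by (auto simp: int_vecs_def)
    show "int_vecs \<subseteq> (\<lambda>r. p + r) ` int_vecs"
    proof
      fix s :: "real^'k" assume "s \<in> int_vecs"
      then have "s - p \<in> int_vecs" using assms by (auto simp: int_vecs_def)
      then show "s \<in> (\<lambda>r. p + r) ` int_vecs" by (intro image_eqI[of _ _ "s - p"]) auto
    qed
  qed
  then have "(\<lambda>r. infnorm (z - r)) ` int_vecs = (\<lambda>r. infnorm (z - (p + r))) ` int_vecs"
    by (metis image_image)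
  then show ?thesis by (simp add: int_dist_def diff_diff_eq)
qed

text \<open>The value of \<open>int_dist (z - \<eta>)\<close> for \<open>\<eta>\<close> a point of the torus.\<close>

lift_definition torus_dist :: "real^('k::finite) \<Rightarrow> 'k torus \<Rightarrow> real" is "\<lambda>z \<eta>. int_dist (z - \<eta>)"
proof -
  fix z x y :: "real^'k" assume "x - y \<in> int_vecs"
  then have "int_dist (z - y - (x - y)) = int_dist (z - y)" by (rule int_dist_diff_int)
  then show "int_dist (z - x) = int_dist (z - y)" by simp
qed


subsection \<open>Badly approximable targets\<close>

definition Bad :: "real^'n^('m::finite) \<Rightarrow> 'm torus set" where
  "Bad A = {\<eta>. Liminf (inf (filtercomap infnorm at_top) (principal int_vecs))
     (\<lambda>q. ereal (infnorm q powr (real CARD('n) / real CARD('m)) * torus_dist (A *v q) \<eta>)) > 0}"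


subsection \<open>The class of matrices\<close>

definition columns_rat_independent :: "real^'n^'m \<Rightarrow> bool" where
  "columns_rat_independent A \<longleftrightarrow>
     (\<forall>c :: 'n \<Rightarrow> rat. (\<Sum>j\<in>UNIV. of_rat (c j) *\<^sub>R column j A) = 0 \<longrightarrow> (\<forall>j. c j = 0))"

text \<open>The function is meaningful for \<open>t \<ge> 1\<close> only: there the set is finite and nonempty.\<close>

definition Psi :: "real^'n^'m \<Rightarrow> real \<Rightarrow> real" where
  "Psi A t = Min {int_dist (A *v q) | q. q \<in> int_vecs \<and> 0 < infnorm q \<and> infnorm q \<le> t}"

text \<open>\<open>M\<close> lists, in increasing order, all discontinuities of \<open>Psi A\<close> as a function on \<open>[1,\<infinity>)\<close>;
  the list starts with \<open>M 0\<close>. That such an infinite list exists forces \<open>A *v q \<notin> int_vecs\<close> for all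
  nonzero \<open>q \<in> int_vecs\<close>, because otherwise \<open>Psi A\<close> is eventually 0.\<close>

definition discontinuity_seq :: "real^'n^'m \<Rightarrow> (nat \<Rightarrow> real) \<Rightarrow> bool" where
  "discontinuity_seq A M \<longleftrightarrow>
     strict_mono M \<and> range M = {t\<in>{1..}. \<not> continuous (at t within {1..}) (Psi A)}"

definition zeta :: "real^'n^'m \<Rightarrow> (nat \<Rightarrow> real) \<Rightarrow> nat \<Rightarrow> real" where
  "zeta A M l = Psi A (M l)"

definition Delta :: "real^'n^'m \<Rightarrow> (nat \<Rightarrow> real) \<Rightarrow> nat \<Rightarrow> real" where
  "Delta A M l = M (l + 1) ^ CARD('n) * zeta A M l ^ CARD('m)"

text \<open>Extended real valued, since the supremum may be infinite.\<close>

definition H_sup :: "real^'n^'m \<Rightarrow> (nat \<Rightarrow> real) \<Rightarrow> (nat \<Rightarrow> nat) \<Rightarrow> nat \<Rightarrow> ereal" where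
  "H_sup A M l k = (SUP k1\<in>{k + 1..}.
     ereal ((zeta A M (l k1) / Delta A M (l k1)) ^ CARD('m) *
            (M (l k + 1) / Delta A M (l k)) ^ CARD('n)))"

definition class_C :: "(real^'n^'m) set" where
  "class_C = {A. columns_rat_independent A \<and>
     (\<exists>M. discontinuity_seq A M \<and>
       (\<exists>l :: nat \<Rightarrow> nat. strict_mono l \<and>
          (\<Sum>k. ennreal (Delta A M (l k) ^ (CARD('m) + CARD('n) - 1))) = \<infinity> \<and>
          H_sup A M l \<longlonglongrightarrow> 0))}"


subsection \<open>The definitions are meaningful\<close>

lemma infnorm_vec_le: "infnorm (x :: real^'k) \<le> t \<longleftrightarrow> (\<forall>i. \<bar>x $ i\<bar> \<le> t)"
proof -
  have "infnorm x = Max ((\<lambda>i. \<bar>x $ i\<bar>) ` UNIV)"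
    unfolding infnorm_cart by (subst cSup_eq_Max) (auto simp: full_SetCompr_eq)
  then show ?thesis by (simp add: Max_le_iff)
qed

lemma finite_int_vecs_le: "finite {p :: real^'k. p \<in> int_vecs \<and> infnorm p \<le> t}"
proof -
  have "finite (Pi\<^sub>E (UNIV :: 'k set) (\<lambda>_. {x :: real. x \<in> \<int> \<and> \<bar>x\<bar> \<le> t}))"
    by (intro finite_PiE finite_abs_int_segment) simp
  then have "finite (vec_lambda ` (Pi\<^sub>E (UNIV :: 'k set) (\<lambda>_. {x :: real. x \<in> \<int> \<and> \<bar>x\<bar> \<le> t})))"
    by simp
  moreover have "{p :: real^'k. \<forall>i. p $ i \<in> {x \<in> \<int>. \<bar>x\<bar> \<le> t}} \<subseteq>
      vec_lambda ` (Pi\<^sub>E (UNIV :: 'k set) (\<lambda>_. {x :: real. x \<in> \<int> \<and> \<bar>x\<bar> \<le> t}))"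
    by (auto intro!: image_eqI[of _ _ "vec_nth _"])
  ultimately have "finite {p :: real^'k. \<forall>i. p $ i \<in> {x \<in> \<int>. \<bar>x\<bar> \<le> t}}"
    by (rule rev_finite_subset)
  then show ?thesis by (rule rev_finite_subset) (auto simp: int_vecs_def infnorm_vec_le)
qed

lemma int_dist_attained:
  "\<exists>p\<in>int_vecs. int_dist z = infnorm (z - p) \<and>
     (\<forall>p'\<in>int_vecs. infnorm (z - p) \<le> infnorm (z - p' :: real^'k))"
proof -
  define p :: "real^'k" where "p = (\<chi> i. of_int (round (z $ i)))"
  have p: "p \<in> int_vecs" by (simp add: p_def int_vecs_def)
  have le: "infnorm (z - p) \<le> infnorm (z - p')" if p': "p' \<in> int_vecs" for p'
  proof -
    have "\<bar>z $ i - p $ i\<bar> \<le> infnorm (z - p')" for i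
    proof -
      obtain a where a: "p' $ i = of_int a" using p' unfolding int_vecs_def by (blast elim: Ints_cases)
      have "\<bar>z $ i - p $ i\<bar> \<le> \<bar>z $ i - p' $ i\<bar>"
        unfolding a using round_diff_minimal[of "z $ i" a] by (simp add: p_def)
      also have "\<dots> \<le> infnorm (z - p')" using infnorm_vec_le[of "z - p'" "infnorm (z - p')"] by simp
      finally show ?thesis .
    qed
    then show ?thesis by (simp add: infnorm_vec_le)
  qed
  have "int_dist z = infnorm (z - p)"
    unfolding int_dist_def by (rule cInf_eq_minimum) (use p le in auto)
  then show ?thesis using p le by blast
qed

lemma Psi_attained:
  fixes A :: "real^'n^'m"
  assumes "t \<ge> 1"
  shows "\<exists>q\<in>int_vecs. 0 < infnorm q \<and> infnorm q \<le> t \<and> Psi A t = int_dist (A *v q)"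
proof -
  let ?Q = "{q :: real^'n. q \<in> int_vecs \<and> 0 < infnorm q \<and> infnorm q \<le> t}"
  let ?S = "{int_dist (A *v q) | q. q \<in> int_vecs \<and> 0 < infnorm q \<and> infnorm q \<le> t}"
  have S: "?S = (\<lambda>q. int_dist (A *v q)) ` ?Q" by auto
  have "finite ?Q" by (rule finite_subset[OF _ finite_int_vecs_le[of t]]) auto
  then have fin: "finite ?S" unfolding S by simp
  have "(1 :: real^'n) \<in> ?Q"
    using assms by (auto simp: int_vecs_def infnorm_vec_le infnorm_pos_lt)
  then have "?S \<noteq> {}" by blast
  from Min_in[OF fin this] show ?thesis unfolding Psi_def by auto
qed

lemma sigma_algebra_torus:
  "sigma_algebra UNIV {B :: ('k::finite) torus set. torus_of -` B \<in> sets lebesgue}"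
  unfolding sigma_algebra_iff2
proof (intro conjI ballI allI impI, goal_cases)
  case (3 a)
  have "torus_of -` (UNIV - a) = UNIV - (torus_of -` a)" by auto
  with 3 show ?case using sets.compl_sets[of "torus_of -` a" lebesgue] by simp
qed (auto simp: vimage_UN)

lemma sets_torus_lebesgue:
  "sets torus_lebesgue = {B :: ('k::finite) torus set. torus_of -` B \<in> sets lebesgue}"
  by (simp add: torus_lebesgue_def sigma_algebra.sigma_sets_eq[OF sigma_algebra_torus])

lemma unit_cube_measure:
  "{x :: real^'k. \<forall>i. 0 \<le> x $ i \<and> x $ i < 1} \<in> sets lebesgue"
  "emeasure lebesgue {x :: real^'k. \<forall>i. 0 \<le> x $ i \<and> x $ i < 1} = 1"
proof -
  let ?I = "{x :: real^'k. \<forall>i. 0 \<le> x $ i \<and> x $ i < 1}"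
  have "Measurable.pred borel (\<lambda>x :: real^'k. \<forall>i. 0 \<le> x $ i \<and> x $ i < 1)"
    by measurable
  then have "?I \<in> sets borel" by (simp add: pred_def)
  then show meas: "?I \<in> sets lebesgue" by simp
  have prod1: "(\<Prod>b\<in>Basis. ((1 :: real^'k) - 0) \<bullet> b) = 1"
    by (intro prod.neutral) (auto simp: Basis_vec_def inner_axis)
  have le1: "(0 :: real^'k) \<bullet> b \<le> 1 \<bullet> b" if "b \<in> Basis" for b
    using that by (auto simp: Basis_vec_def inner_axis)
  have "emeasure lebesgue (box 0 (1 :: real^'k)) \<le> emeasure lebesgue ?I"
    by (intro emeasure_mono meas) (auto simp: mem_box_cart less_imp_le)
  moreover have "emeasure lebesgue ?I \<le> emeasure lebesgue (cbox 0 (1 :: real^'k))"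
    by (intro emeasure_mono) (auto simp: mem_box_cart less_imp_le)
  ultimately show "emeasure lebesgue ?I = 1"
    using emeasure_lborel_box[OF le1] emeasure_lborel_cbox[OF le1] prod1 by simp
qed

lemma emeasure_torus_lebesgue:
  fixes B :: "('k::finite) torus set"
  assumes "B \<in> sets torus_lebesgue"
  shows "emeasure torus_lebesgue B =
    emeasure lebesgue (torus_of -` B \<inter> {x :: real^'k. \<forall>i. 0 \<le> x $ i \<and> x $ i < 1})"
proof -
  let ?I = "{x :: real^'k. \<forall>i. 0 \<le> x $ i \<and> x $ i < 1}"
  let ?S = "sigma UNIV {B :: 'k torus set. torus_of -` B \<in> sets lebesgue}"
  have "torus_of \<in> measurable lebesgue ?S"
    by (rule measurable_measure_of) auto
  then have "torus_of \<in> measurable (restrict_space lebesgue ?I) ?S"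
    by (rule measurable_restrict_space1)
  moreover have "B \<in> sets ?S" using assms by (simp add: torus_lebesgue_def)
  ultimately show ?thesis
    using unit_cube_measure(1)[where 'k='k] unfolding torus_lebesgue_def
    by (simp add: emeasure_distr space_restrict_space emeasure_restrict_space)
qed

lemma prob_space_torus_lebesgue: "prob_space (torus_lebesgue :: ('k::finite) torus measure)"
proof
  have "space torus_lebesgue = (UNIV :: 'k torus set)" by (simp add: torus_lebesgue_def)
  then show "emeasure torus_lebesgue (space torus_lebesgue :: 'k torus set) = 1"
    using emeasure_torus_lebesgue[of "UNIV :: 'k torus set"] unit_cube_measure(2)[where 'k='k]
    by (simp add: sets_torus_lebesgue)
qed

end

theory Submission
  imports Defs
begin

text \<open>Put \<open>R\<^sub>k = \<zeta> / \<Delta>\<close> and \<open>X\<^sub>k = M' / \<Delta>\<close>, where \<open>\<zeta>\<close>, \<open>\<Delta>\<close> are taken at the index \<open>l\<^sub>k\<close> and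
  \<open>M'\<close> at \<open>l\<^sub>k + 1\<close>. Since the lattice of the points \<open>(A q - p, q)\<close> has no nonzero point in the
  box with half-sides \<open>\<zeta>\<close> and \<open>M'\<close>, a packing argument bounds its covering radius: every target is
  within \<open>R\<^sub>k\<close> of some \<open>A q - p\<close> with \<open>\<parallel>q\<parallel> \<le> X\<^sub>k\<close>. Hence each cell of a grid of mesh comparable to
  \<open>R\<^sub>k\<close> contains a cube of half-side \<open>r\<^sub>k = (\<epsilon> / X\<^sub>k\<^sup>n)\<^sup>1\<^sup>/\<^sup>m\<close> centred at such a point. The union \<open>E\<^sub>k\<close> of
  these cubes has measure comparable to \<open>(r\<^sub>k / R\<^sub>k)\<^sup>m = \<epsilon> \<Delta>\<^sup>d\<^sup>-\<^sup>1\<close>, so the measures have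
  divergent sum, and \<open>H\<^sub>k \<rightarrow> 0\<close> says that \<open>R\<^sub>j / r\<^sub>k \<rightarrow> 0\<close> for \<open>j > k\<close>, so that \<open>E\<^sub>j\<close> is equidistributed
  in each cube of \<open>E\<^sub>k\<close> and the \<open>E\<^sub>k\<close> are asymptotically pairwise independent with constant 1.
  By the second moment method almost every target lies in infinitely many \<open>E\<^sub>k\<close>, for every \<open>\<epsilon> > 0\<close>.\<close>


subsection \<open>Quasi-independent events\<close>

text \<open>A converse to the Borel-Cantelli lemma by the second moment method. The number of events
  that occur in a long late block has mean \<open>V\<close> and variance at most
  \<open>V + e * V^2\<close>, so it vanishes with probability at most \<open>1 / V + e\<close>.
  Because the correlation constant tends to 1, the limsup set has full measure and not merely
  positive measure.\<close>

lemma (in prob_space) AE_infinitely_often_if_quasi_independent: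
  fixes E :: "nat \<Rightarrow> 'a set"
  assumes E: "\<And>k. E k \<in> events"
    and div: "\<not> summable (\<lambda>k. prob (E k))"
    and qi: "\<And>e. e > 0 \<Longrightarrow> \<exists>K. \<forall>k\<ge>K. \<forall>j>k. prob (E k \<inter> E j) \<le> (1 + e) * prob (E k) * prob (E j)"
  shows "AE x in M. \<exists>\<^sub>\<infinity>k. x \<in> E k"
proof -
  define Z where "Z K = {x \<in> space M. \<forall>k\<ge>K. x \<notin> E k}" for K
  have Z_eq: "Z K = space M - (\<Union>k\<in>{K..}. E k)" for K
    unfolding Z_def by auto
  have Z_ev: "Z K \<in> events" for K
    unfolding Z_eq using E by auto
  \<comment> \<open>One \<open>e\<close> comes from the correlation constant, the other from
    \<open>1 / V < e\<close>.\<close>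
  have small: "prob (Z K0) \<le> 2 * e" if "e > 0" for K0 e
  proof -
    obtain K1 where K1: "\<And>k j. k \<ge> K1 \<Longrightarrow> j > k \<Longrightarrow> prob (E k \<inter> E j) \<le> (1 + e) * prob (E k) * prob (E j)"
      using qi[OF \<open>e > 0\<close>] by blast
    define K where "K = max K0 K1"
    \<comment> \<open>The diagonal terms escape quasi-independence, but they add only
      \<open>V\<close> to the double sum. The case \<open>k > j\<close> follows by symmetry of the
      intersection.\<close>
    have pair: "prob (E k \<inter> E j) \<le> (1 + e) * (prob (E k) * prob (E j)) + (if k = j then prob (E k) else 0)"
      if "k \<ge> K" "j \<ge> K" for k j
    proof -
      have "0 \<le> (1 + e) * (prob (E k) * prob (E j))"
        using \<open>e > 0\<close> by simp
      then show ?thesis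
        using K1[of k j] K1[of j k] that by (cases k j rule: linorder_cases) (auto simp: K_def Int_commute mult_ac)
    qed
    have "\<exists>N. (\<Sum>k<N. prob (E k)) > (\<Sum>k<K. prob (E k)) + 1 / e"
    proof (rule ccontr)
      assume "\<nexists>N. (\<Sum>k<N. prob (E k)) > (\<Sum>k<K. prob (E k)) + 1 / e"
      then have "summable (\<lambda>k. prob (E k))"
        by (intro summableI_nonneg_bounded) (auto simp: not_less)
      with div show False ..
    qed
    then obtain N where N: "(\<Sum>k<N. prob (E k)) > (\<Sum>k<K. prob (E k)) + 1 / e"
      by blast
    define V where "V = (\<Sum>k\<in>{K..<N}. prob (E k))"
    have "K \<le> N"
    proof (rule ccontr)
      assume "\<not> K \<le> N"
      then have "(\<Sum>k<N. prob (E k)) \<le> (\<Sum>k<K. prob (E k))"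
        by (intro sum_mono2) auto
      then show False using N \<open>e > 0\<close> by (smt (verit) divide_pos_pos)
    qed
    then have "(\<Sum>k<N. prob (E k)) = (\<Sum>k<K. prob (E k)) + V"
      unfolding V_def by (simp add: lessThan_atLeast0 sum.atLeastLessThan_concat)
    with N have V: "V > 1 / e" by simp
    then have "V > 0" using \<open>e > 0\<close> by (smt (verit) divide_pos_pos)
    \<comment> \<open>Chebyshev's inequality for the counting function \<open>S\<close>, which vanishes on \<open>Z K\<close> and has mean \<open>V\<close>.\<close>
    define S where "S x = (\<Sum>k\<in>{K..<N}. indicator (E k) x :: real)" for x
    have sq: "(S x - V)\<^sup>2 = (\<Sum>k\<in>{K..<N}. \<Sum>j\<in>{K..<N}. indicator (E k \<inter> E j) x)
        - 2 * V * (\<Sum>k\<in>{K..<N}. indicator (E k) x) + V\<^sup>2" for x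
      unfolding S_def power2_diff
      by (simp only: power2_eq_square sum_product indicator_inter_arith) (simp add: mult_ac)
    have int: "integrable M (indicator (E k) :: 'a \<Rightarrow> real)"
        "integrable M (indicator (E k \<inter> E j) :: 'a \<Rightarrow> real)" for k j
      using E by (auto intro!: integrable_real_indicator simp: emeasure_eq_measure)
    have intS: "integrable M (\<lambda>x. (S x - V)\<^sup>2)"
      unfolding sq by (intro Bochner_Integration.integrable_add Bochner_Integration.integrable_diff Bochner_Integration.integrable_sum
        integrable_mult_right int integrable_const)
    have val: "(\<integral>x. (S x - V)\<^sup>2 \<partial>M) = (\<Sum>k\<in>{K..<N}. \<Sum>j\<in>{K..<N}. prob (E k \<inter> E j)) - 2 * V * V + V\<^sup>2"
      unfolding sq using E
      by (simp add: int Bochner_Integration.integrable_sum Bochner_Integration.integrable_diff Bochner_Integration.integral_sum V_def prob_space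
          Int_absorb2 sets.sets_into_space)
    have dbl: "(\<Sum>k\<in>{K..<N}. \<Sum>j\<in>{K..<N}. prob (E k \<inter> E j)) \<le> (1 + e) * V\<^sup>2 + V"
    proof -
      have "(\<Sum>k\<in>{K..<N}. \<Sum>j\<in>{K..<N}. prob (E k \<inter> E j)) \<le>
         (\<Sum>k\<in>{K..<N}. \<Sum>j\<in>{K..<N}. (1 + e) * (prob (E k) * prob (E j)) + (if k = j then prob (E k) else 0))"
        by (intro sum_mono pair) auto
      also have "\<dots> = (1 + e) * V\<^sup>2 + V"
        by (simp add: sum.distrib V_def power2_eq_square sum_product flip: sum_distrib_left)
      finally show ?thesis .
    qed
    have "V\<^sup>2 * prob (Z K) = (\<integral>x. V\<^sup>2 * indicator (Z K) x \<partial>M)"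
      using Z_ev[of K] by (simp add: Int_absorb2 sets.sets_into_space)
    also have "\<dots> \<le> (\<integral>x. (S x - V)\<^sup>2 \<partial>M)"
    proof (intro integral_mono intS)
      show "integrable M (\<lambda>x. V\<^sup>2 * indicator (Z K) x)"
        using Z_ev[of K] by (auto intro!: integrable_real_indicator simp: emeasure_eq_measure)
      fix x assume "x \<in> space M"
      have "S x = 0" if "x \<in> Z K"
        using that unfolding S_def Z_def by (intro sum.neutral) auto
      then show "V\<^sup>2 * indicator (Z K) x \<le> (S x - V)\<^sup>2"
        by (auto simp: indicator_def)
    qed
    also have "\<dots> \<le> V + e * V\<^sup>2"
      using val dbl by (simp add: power2_eq_square algebra_simps)
    finally have "V * (V * prob (Z K)) \<le> V * (1 + e * V)"
      by (simp add: power2_eq_square algebra_simps)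
    then have "V * prob (Z K) \<le> 1 + e * V" using \<open>V > 0\<close> by simp
    also have "\<dots> \<le> V * (2 * e)"
      using V \<open>e > 0\<close> by (simp add: field_simps)
    finally have "prob (Z K) \<le> 2 * e" using \<open>V > 0\<close> by simp
    moreover have "prob (Z K0) \<le> prob (Z K)"
      by (intro finite_measure_mono Z_ev) (auto simp: Z_def K_def)
    ultimately show ?thesis by simp
  qed
  have "prob (Z K) = 0" for K
  proof (rule antisym)
    show "prob (Z K) \<le> 0"
    proof (rule field_le_epsilon)
      show "prob (Z K) \<le> 0 + e" if "e > 0" for e
        using small[of "e / 2" K] that by simp
    qed
  qed simp
  then have "AE x in M. x \<notin> Z K" for K
    using Z_ev[of K] by (intro AE_not_in null_setsI) (simp_all add: emeasure_eq_measure)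
  then have "AE x in M. \<forall>K. x \<notin> Z K"
    by (simp add: AE_all_countable)
  then show ?thesis
    by (rule AE_mp) (auto simp: Z_def INFM_nat_le intro!: AE_I2)
qed


subsection \<open>The covering radius of a lattice\<close>

lemma infnorm_less_iff: "infnorm (x :: 'a::euclidean_space) < t \<longleftrightarrow> (\<forall>b\<in>Basis. \<bar>x \<bullet> b\<bar> < t)"
  unfolding infnorm_Max by (subst Max_less_iff) auto

lemma infnorm_Pair: "infnorm (a, b) = max (infnorm a) (infnorm b)"
proof (rule antisym)
  show "infnorm (a, b) \<le> max (infnorm a) (infnorm b)"
    unfolding infnorm_Max[of "(a,b)"]
    by (rule Max.boundedI)
       (auto simp: Basis_prod_def Basis_le_infnorm le_max_iff_disj)
  have "infnorm a \<le> infnorm (a, b)" "infnorm b \<le> infnorm (a, b)"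
    using Basis_le_infnorm[of "(_, 0)" "(a, b)"] Basis_le_infnorm[of "(0, _)" "(a, b)"]
    by (auto simp: infnorm_Max[of a] infnorm_Max[of b] Basis_prod_def intro!: Max.boundedI)
  then show "max (infnorm a) (infnorm b) \<le> infnorm (a, b)" by simp
qed

text \<open>Radius \<open>1 / 2\<close> makes the ball a unit cube, so that each point contributes
  exactly 1 in the packing bound.\<close>

lemma emeasure_infnorm_ball:
  "emeasure lborel {x. infnorm (x - c :: 'a::euclidean_space) < 1 / 2} = 1"
proof -
  have "{x. infnorm (x - c) < 1 / 2} = box (c - (1 / 2) *\<^sub>R One) (c + (1 / 2) *\<^sub>R One)"
    unfolding infnorm_less_iff
    by (rule set_eqI, simp add: mem_box inner_diff_left inner_add_left abs_less_iff, intro ball_cong refl) (auto simp: abs_real_def)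
  also have "emeasure lborel \<dots> = 1"
    by (subst emeasure_lborel_box) (auto simp: algebra_simps)
  finally show ?thesis .
qed

text \<open>Balls of radius \<open>1 / 2\<close> around the points of \<open>Y\<close> are folded
  into the fundamental domain \<open>D\<close> by lattice translations. The separation hypotheses
  make all pieces disjoint, so the total mass, 1 per point, fits into \<open>D\<close>.\<close>

lemma card_le_measure_fundamental_domain:
  fixes L D Y :: "'a::euclidean_space set"
  assumes "countable L" and add: "\<And>u v. u \<in> L \<Longrightarrow> v \<in> L \<Longrightarrow> u - v \<in> L"
    and D: "D \<in> sets borel"
    and ex1: "\<And>x. \<exists>!v. v \<in> L \<and> x - v \<in> D"
    and "finite Y"
    and sep: "\<And>v. v \<in> L \<Longrightarrow> v \<noteq> 0 \<Longrightarrow> infnorm v \<ge> 1"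
    and sepY: "\<And>y y' v. y \<in> Y \<Longrightarrow> y' \<in> Y \<Longrightarrow> y \<noteq> y' \<Longrightarrow> v \<in> L \<Longrightarrow> infnorm (y - y' - v) \<ge> 1"
  shows "of_nat (card Y) \<le> emeasure lborel D"
proof -
  define B where "B c = {x :: 'a. infnorm (x - c) < 1 / 2}" for c
  have B: "B c \<in> sets borel" for c
    unfolding B_def by (intro borel_open) (intro open_Collect_less continuous_intros continuous_on_infnorm)
  have half: "infnorm (c - c') < 1" if "x \<in> B c" "x \<in> B c'" for x c c'
    using that infnorm_triangle[of "x - c'" "c - x"] infnorm_sub[of c x] by (simp add: B_def)
  have tr: "(\<lambda>x. x + v) -` S \<in> sets borel" if "S \<in> sets borel" for v :: 'a and S
    using measurable_sets[of "\<lambda>x. x + v" borel borel S] that by simp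
  have shift: "emeasure lborel S = emeasure lborel ((\<lambda>x. x + v) -` S)" if "S \<in> sets borel" for S and v :: 'a
  proof -
    have "emeasure lborel S = emeasure (distr lborel borel ((+) v)) S"
      by (simp add: lborel_distr_plus)
    also have "\<dots> = emeasure lborel ((+) v -` S)"
      using that by (simp add: emeasure_distr)
    also have "(+) v -` S = (\<lambda>x. x + v) -` S" by (auto simp: add.commute)
    finally show ?thesis .
  qed
  define DL where "DL v = {x. x - v \<in> D}" for v
  have DLm: "DL v \<in> sets borel" for v
    using tr[OF D, of "- v"] by (simp add: DL_def vimage_def)
  have UN: "(\<Union>v\<in>L. B y \<inter> DL v) = B y" for y
    using ex1 by (fastforce simp: DL_def)
  \<comment> \<open>The ball at \<open>y\<close> is cut along the translates of \<open>D\<close>,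
    and each piece is shifted back into \<open>D\<close>; translation invariance keeps the
    mass.\<close>
  have "1 = (\<integral>\<^sup>+ v. emeasure lborel (B (y - v) \<inter> D) \<partial>count_space L)" for y
  proof -
    have "1 = emeasure lborel (\<Union>v\<in>L. B y \<inter> DL v)"
      by (simp only: UN) (simp only: B_def emeasure_infnorm_ball)
    also have "\<dots> = (\<integral>\<^sup>+ v. emeasure lborel (B y \<inter> DL v) \<partial>count_space L)"
    proof (rule emeasure_UN_countable)
      show "disjoint_family_on (\<lambda>v. B y \<inter> DL v) L"
        using ex1 by (auto simp: disjoint_family_on_def DL_def)
    qed (use B DLm \<open>countable L\<close> in auto)
    also have "\<dots> = (\<integral>\<^sup>+ v. emeasure lborel (B (y - v) \<inter> D) \<partial>count_space L)"
    proof (intro nn_integral_cong)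
      fix v
      have "(\<lambda>x. x + v) -` (B y \<inter> DL v) = B (y - v) \<inter> D"
        by (auto simp: B_def DL_def algebra_simps)
      then show "emeasure lborel (B y \<inter> DL v) = emeasure lborel (B (y - v) \<inter> D)"
        using shift[of "B y \<inter> DL v" v] B DLm by auto
    qed
    finally show ?thesis .
  qed
  then have "of_nat (card Y) = (\<Sum>y\<in>Y. \<integral>\<^sup>+ v. emeasure lborel (B (y - v) \<inter> D) \<partial>count_space L)"
    by simp
  \<comment> \<open>The shifted pieces are now disjoint subsets of \<open>D\<close>:
    \<open>sep\<close> separates pieces of one ball, \<open>sepY\<close> those of different
    balls.\<close>
  also have "\<dots> = (\<Sum>y\<in>Y. emeasure lborel (\<Union>v\<in>L. B (y - v) \<inter> D))"
  proof (intro sum.cong refl emeasure_UN_countable[symmetric])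
    fix y
    show "disjoint_family_on (\<lambda>v. B (y - v) \<inter> D) L"
    proof (unfold disjoint_family_on_def, intro ballI impI)
      fix u v assume "u \<in> L" "v \<in> L" "u \<noteq> v"
      then have "infnorm (v - u) \<ge> 1" using add sep by simp
      then show "B (y - u) \<inter> D \<inter> (B (y - v) \<inter> D) = {}"
        using half[of _ "y - u" "y - v"] by fastforce
    qed
  qed (use B D \<open>countable L\<close> in auto)
  also have "\<dots> = emeasure lborel (\<Union>y\<in>Y. \<Union>v\<in>L. B (y - v) \<inter> D)"
  proof (rule sum_emeasure)
    show "disjoint_family_on (\<lambda>y. \<Union>v\<in>L. B (y - v) \<inter> D) Y"
    proof (unfold disjoint_family_on_def, intro ballI impI)
      fix y y' assume yy: "y \<in> Y" "y' \<in> Y" "y \<noteq> y'"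
      have "False" if "x \<in> B (y - u)" "x \<in> B (y' - v)" "u \<in> L" "v \<in> L" for x u v
        using half[OF that(1,2)] sepY[OF yy add[OF that(3,4)]] by (simp add: algebra_simps)
      then show "(\<Union>v\<in>L. B (y - v) \<inter> D) \<inter> (\<Union>v\<in>L. B (y' - v) \<inter> D) = {}"
        by blast
    qed
  qed (use B D \<open>countable L\<close> \<open>finite Y\<close> in \<open>auto intro!: sets.countable_UN'\<close>)
  also have "\<dots> \<le> emeasure lborel D"
    using D by (intro emeasure_mono) auto
  finally show ?thesis .
qed

text \<open>If \<open>y\<close> had distance at least \<open>h\<close> from \<open>L\<close>, the segment from \<open>0\<close> to \<open>y\<close> would contain points at
  distance \<open>0, 1, \<dots>, h\<close> from \<open>L\<close>. They are 1-separated modulo \<open>L\<close>, so \<open>h + 1 \<le> V\<close>.\<close>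

lemma covering_radius_less:
  fixes L D :: "'a::euclidean_space set"
  assumes "countable L" and "0 \<in> L" and diff: "\<And>u v. u \<in> L \<Longrightarrow> v \<in> L \<Longrightarrow> u - v \<in> L"
    and D: "D \<in> sets borel" "emeasure lborel D = ennreal V"
    and ex1: "\<And>x. \<exists>!v. v \<in> L \<and> x - v \<in> D"
    and sep: "\<And>v. v \<in> L \<Longrightarrow> v \<noteq> 0 \<Longrightarrow> infnorm v \<ge> 1"
  shows "\<exists>v\<in>L. infnorm (y - v) < V" and "V \<ge> 1"
proof -
  define d where "d w = (INF v\<in>L. infnorm (w - v))" for w
  have bdd: "bdd_below ((\<lambda>v. infnorm (w - v)) ` L)" for w
    by (intro bdd_belowI2[of _ 0]) (simp add: infnorm_pos_le)
  have d_le: "d w \<le> infnorm (w - v)" if "v \<in> L" for w v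
    unfolding d_def using that bdd by (intro cINF_lower)
  have d_less: "\<exists>v\<in>L. infnorm (w - v) < a" if "d w < a" for w a
    using that \<open>0 \<in> L\<close> bdd unfolding d_def by (subst (asm) cINF_less_iff) auto
  have d_ge0: "d w \<ge> 0" for w
    unfolding d_def using \<open>0 \<in> L\<close> by (intro cINF_greatest) (auto simp: infnorm_pos_le)
  have add: "u + v \<in> L" if "u \<in> L" "v \<in> L" for u v
    using diff[OF that(1) diff[OF \<open>0 \<in> L\<close> that(2)]] by simp
  \<comment> \<open>This single inequality says that \<open>d\<close> is 1-Lipschitz (take
    \<open>v = 0\<close>) and that points at which \<open>d\<close> differs by at least 1 are
    1-separated modulo \<open>L\<close>.\<close>
  have d_diff: "d w - d w' \<le> infnorm (w - w' - v)" if "v \<in> L" for w w' v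
  proof (rule field_le_epsilon)
    fix e :: real assume "e > 0"
    then obtain u where u: "u \<in> L" "infnorm (w' - u) < d w' + e"
      using d_less[of w' "d w' + e"] by auto
    have "d w \<le> infnorm (w - (u + v))" using d_le add u that by blast
    also have "\<dots> \<le> infnorm (w - w' - v) + infnorm (w' - u)"
      using infnorm_triangle[of "w - w' - v" "w' - u"] by (simp add: algebra_simps)
    finally show "d w - d w' \<le> infnorm (w - w' - v) + e" using u by simp
  qed
  have d0: "d 0 = 0"
    using d_le[OF \<open>0 \<in> L\<close>, of 0] d_ge0[of 0] by (simp add: infnorm_0)
  have "d y < V \<and> 1 \<le> V"
  proof -
    have "\<bar>d w - d w'\<bar> \<le> norm (w - w')" for w w'
      using d_diff[OF \<open>0 \<in> L\<close>, of w w'] d_diff[OF \<open>0 \<in> L\<close>, of w' w] infnorm_sub[of w w'] infnorm_le_norm[of "w - w'"]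
      by auto
    then have "1-lipschitz_on UNIV d"
      by (intro lipschitz_onI) (auto simp: dist_norm)
    then have "continuous_on UNIV d" by (rule lipschitz_on_continuous_on)
    then have cont: "continuous_on {0..1} (\<lambda>t. d (t *\<^sub>R y))"
      by (rule continuous_on_compose2) (auto intro!: continuous_intros)
    \<comment> \<open>Rounding down gives \<open>d y < h + 1\<close>, so the packing bound
      \<open>h + 1 \<le> V\<close> yields both conclusions at once.\<close>
    define h where "h = nat \<lfloor>d y\<rfloor>"
    have h: "real h \<le> d y" "d y < real h + 1"
      using d_ge0[of y] unfolding h_def by linarith+
    have "\<exists>t. d (t *\<^sub>R y) = real j" if "j \<le> h" for j
      using IVT'[of "\<lambda>t. d (t *\<^sub>R y)" 0 "real j" 1] cont d0 h that by fastforce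
    then obtain t where t: "\<And>j. j \<le> h \<Longrightarrow> d (t j *\<^sub>R y) = real j" by metis
    define Y where "Y = (\<lambda>j. t j *\<^sub>R y) ` {..h}"
    have "inj_on (\<lambda>j. t j *\<^sub>R y) {..h}"
      by (rule inj_onI) (metis atMost_iff of_nat_eq_iff t)
    then have "card Y = h + 1" by (simp add: Y_def card_image)
    moreover have "of_nat (card Y) \<le> emeasure lborel D"
    proof (rule card_le_measure_fundamental_domain[OF \<open>countable L\<close> diff D(1) ex1 _ sep])
      show "finite Y" by (simp add: Y_def)
      fix w w' v assume "w \<in> Y" "w' \<in> Y" "w \<noteq> w'" "v \<in> L"
      then obtain i j where ij: "i \<le> h" "j \<le> h" "w = t i *\<^sub>R y" "w' = t j *\<^sub>R y" "i \<noteq> j"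
        by (auto simp: Y_def)
      have "d w' - d w \<le> infnorm (w' - w - (0 - v))"
        by (intro d_diff diff \<open>0 \<in> L\<close> \<open>v \<in> L\<close>)
      also have "\<dots> = infnorm (w - w' - v)"
        by (subst infnorm_neg[symmetric]) (simp add: algebra_simps)
      finally have "\<bar>real i - real j\<bar> \<le> infnorm (w - w' - v)"
        using d_diff[OF \<open>v \<in> L\<close>, of w w'] ij t by auto
      then show "1 \<le> infnorm (w - w' - v)" using \<open>i \<noteq> j\<close> by linarith
    qed
    ultimately have "ennreal (real (h + 1)) \<le> ennreal V"
      by (simp add: D(2) ennreal_of_nat_eq_real_of_nat)
    \<comment> \<open>\<open>ennreal\<close> truncates a negative \<open>V\<close> to 0; the
      positive left side excludes that case.\<close>
    then have "real (h + 1) \<le> V"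
      by (subst (asm) ennreal_le_iff2) auto
    then show ?thesis using h by simp
  qed
  then show "\<exists>v\<in>L. infnorm (y - v) < V" "V \<ge> 1" using d_less by auto
qed


subsection \<open>Cubes in the cells of a grid\<close>

text \<open>Half-open, so that grid cells and integer translates of the unit cube tile space with
  every point in exactly one of them.\<close>

definition half_open_cube :: "real^'k \<Rightarrow> real \<Rightarrow> (real^'k) set" where
  "half_open_cube a s = {x. \<forall>i. a $ i \<le> x $ i \<and> x $ i < a $ i + s}"

lemma sets_half_open_cube [measurable, simp]:
  fixes a :: "real^'k"
  shows "half_open_cube a s \<in> sets borel"
proof -
  have "Measurable.pred borel (\<lambda>x :: real^'k. \<forall>i. a $ i \<le> x $ i \<and> x $ i < a $ i + s)"
    by measurable
  then show ?thesis by (simp add: pred_def half_open_cube_def)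
qed

lemma emeasure_half_open_cube:
  fixes a :: "real^'k"
  assumes "s \<ge> 0"
  shows "emeasure lborel (half_open_cube a s) = ennreal (s ^ CARD('k))"
proof -
  define b where "b = a + (\<chi> i. s)"
  have ip: "(b - a) \<bullet> c = s" if "c \<in> Basis" for c
    using that by (auto simp: b_def Basis_vec_def inner_axis)
  have le: "a \<bullet> c \<le> b \<bullet> c" if "c \<in> Basis" for c
    using ip[OF that] \<open>s \<ge> 0\<close> by (simp add: inner_diff_left)
  have prod: "(\<Prod>c\<in>Basis. (b - a) \<bullet> c) = s ^ CARD('k)"
    using ip by simp
  have "emeasure lborel (box a b) \<le> emeasure lborel (half_open_cube a s)"
    by (intro emeasure_mono) (auto simp: half_open_cube_def mem_box_cart b_def less_imp_le)
  moreover have "emeasure lborel (half_open_cube a s) \<le> emeasure lborel (cbox a b)"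
    by (intro emeasure_mono) (auto simp: half_open_cube_def mem_box_cart b_def less_imp_le)
  ultimately show ?thesis
    using emeasure_lborel_box[OF le] emeasure_lborel_cbox[OF le] prod by simp
qed

lemma fmeasurable_half_open_cube [simp]:
  "half_open_cube (a :: real^'k) s \<in> fmeasurable lborel"
proof (cases "s \<ge> 0")
  case True
  then show ?thesis by (intro fmeasurableI) (auto simp: emeasure_half_open_cube)
next
  case False
  then have "half_open_cube a s = {}" by (fastforce simp: half_open_cube_def)
  then show ?thesis by simp
qed

lemma measure_half_open_cube:
  "s \<ge> 0 \<Longrightarrow> measure lborel (half_open_cube (a :: real^'k) s) = s ^ CARD('k)"
  by (simp add: measure_def emeasure_half_open_cube)

text \<open>The unit cube is cut into cells of side \<open>1 / N\<close>. By \<open>fit\<close>, a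
  cube of half-side \<open>r\<close> around a point within \<open>R\<close> of the centre of a cell
  stays inside that cell. All cells are filled in the same proportion \<open>v\<close>, so
  \<open>E\<close> looks uniform of density \<open>v\<close> down to the scale \<open>1 / N\<close>:
  a test cube only has to be enlarged by one cell on each side.\<close>

lemma exists_grid_of_cubes:
  fixes P :: "real^'k \<Rightarrow> bool"
  assumes "N > 0" "r > 0" and fit: "R + r \<le> 1 / (2 * real N)"
    and near: "\<And>y. \<exists>c. P c \<and> infnorm (y - c) \<le> R"
    and v: "v = (2 * r * real N) ^ CARD('k)"
  obtains E S where "E \<in> sets borel" "E \<subseteq> half_open_cube 0 1" "finite S"
    "\<And>x. x \<in> E \<Longrightarrow> \<exists>c. P c \<and> infnorm (x - c) \<le> r"
    "E \<subseteq> (\<Union>a\<in>S. half_open_cube a (2 * r))"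
    "real (card S) * (2 * r) ^ CARD('k) \<le> v"
    "measure lborel E = v"
    "\<And>a \<rho>. \<rho> > 0 \<Longrightarrow> measure lborel (E \<inter> half_open_cube a \<rho>) \<le> v * (\<rho> + 2 / real N) ^ CARD('k)"
proof -
  define I where "I = {g :: 'k \<Rightarrow> int. \<forall>i. g i \<in> {0..<int N}}"
  have "finite (Pi\<^sub>E (UNIV :: 'k set) (\<lambda>_. {0..<int N}))"
    by (intro finite_PiE) auto
  then have "finite I" by (simp add: I_def PiE_def Pi_def)
  define G where "G g = half_open_cube ((\<chi> i. of_int (g i) / real N) :: real^'k) (1 / real N)" for g :: "'k \<Rightarrow> int"
  have G_iff: "x \<in> G g \<longleftrightarrow> (\<forall>i. g i = \<lfloor>real N * x $ i\<rfloor>)" for x g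
    unfolding G_def half_open_cube_def using \<open>N > 0\<close>
    by (auto simp: field_simps floor_eq_iff eq_commute[of "g _"])
  have UNG: "(\<Union>g\<in>I. G g) = half_open_cube 0 1"
  proof (intro set_eqI iffI)
    fix x :: "real^'k"
    assume "x \<in> half_open_cube 0 1"
    then have "0 \<le> real N * x $ i \<and> real N * x $ i < real N" for i
      using \<open>N > 0\<close> by (simp add: half_open_cube_def)
    then have "(\<lambda>i. \<lfloor>real N * x $ i\<rfloor>) \<in> I"
      by (auto simp: I_def floor_less_iff)
    then show "x \<in> (\<Union>g\<in>I. G g)" using G_iff by blast
  next
    fix x assume "x \<in> (\<Union>g\<in>I. G g)"
    then have "0 \<le> \<lfloor>real N * x $ i\<rfloor> \<and> \<lfloor>real N * x $ i\<rfloor> < int N" for i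
      unfolding UN_iff G_iff I_def by auto
    then have "0 \<le> real N * x $ i \<and> real N * x $ i < real N" for i
      by (simp add: floor_less_iff)
    then show "x \<in> half_open_cube 0 1"
      using \<open>N > 0\<close> by (simp add: half_open_cube_def zero_le_mult_iff)
  qed
  have disjG: "disjoint_family_on G J" for J
    unfolding disjoint_family_on_def by (auto simp: G_iff fun_eq_iff)
  have mG: "measure lborel (G g) = (1 / real N) ^ CARD('k)" for g
    by (simp add: G_def measure_half_open_cube)
  have unionG: "measure lborel (\<Union>g\<in>J. G g) = real (card J) * (1 / real N) ^ CARD('k)" if "finite J" for J
  proof -
    have "measure lborel (\<Union>g\<in>J. G g) = (\<Sum>g\<in>J. measure lborel (G g))"
    proof (intro measure_finite_Union that disjG)
    qed (auto simp: G_def emeasure_half_open_cube)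
    then show ?thesis by (simp add: mG)
  qed
  \<comment> \<open>The number of cells is read off from the volume of the unit cube.\<close>
  have cardI: "real (card I) * (1 / real N) ^ CARD('k) = 1"
    using unionG[OF \<open>finite I\<close>] unfolding UNG by (simp add: measure_half_open_cube)
  have "\<exists>c. P c \<and> infnorm ((\<chi> i. (of_int (g i) + 1 / 2) / real N) - c) \<le> R" for g :: "'k \<Rightarrow> int"
    by (rule near)
  then obtain c where c: "\<And>g. P (c g)"
      "\<And>g. infnorm ((\<chi> i. (of_int (g i) + 1 / 2) / real N) - c g) \<le> R" by metis
  define a where "a g = (\<chi> i. c g $ i - r)" for g
  define C where "C g = half_open_cube (a g) (2 * r)" for g
  have CG: "C g \<subseteq> G g" for g
  proof
    fix x assume x: "x \<in> C g"
    have "of_int (g i) / real N \<le> x $ i \<and> x $ i < of_int (g i) / real N + 1 / real N" for i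
    proof -
      have "\<bar>(of_int (g i) + 1 / 2) / real N - c g $ i\<bar> \<le> R"
        using c(2)[of g] by (simp add: infnorm_vec_le)
      moreover have "(of_int (g i) + 1 / 2) / real N = of_int (g i) / real N + 1 / (2 * real N)"
        "1 / real N = 1 / (2 * real N) + 1 / (2 * real N)"
        by (simp_all add: add_divide_distrib)
      moreover have "c g $ i - r \<le> x $ i \<and> x $ i < c g $ i - r + 2 * r"
        using x by (simp add: C_def half_open_cube_def a_def)
      ultimately show ?thesis using fit by linarith
    qed
    then show "x \<in> G g" by (simp add: G_def half_open_cube_def)
  qed
  have mC: "measure lborel (C g) = (2 * r) ^ CARD('k)" for g
    using \<open>r > 0\<close> by (simp add: C_def measure_half_open_cube)
  \<comment> \<open>\<open>v\<close> is the proportion of the volume of a cell that its small cube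
    occupies.\<close>
  have vN: "(2 * r) ^ CARD('k) = v * (1 / real N) ^ CARD('k)"
    using \<open>N > 0\<close> by (simp add: v power_mult_distrib power_divide)
  have "v > 0" using \<open>N > 0\<close> \<open>r > 0\<close> by (simp add: v)
  define E where "E = (\<Union>g\<in>I. C g)"
  show thesis
  proof (rule that[of E "a ` I"])
    show "E \<in> sets borel"
      using \<open>finite I\<close> by (auto simp: E_def C_def)
    show "E \<subseteq> half_open_cube 0 1"
      unfolding UNG[symmetric] E_def using CG by blast
    show "finite (a ` I)" using \<open>finite I\<close> by simp
    show "E \<subseteq> (\<Union>b\<in>a ` I. half_open_cube b (2 * r))"
      by (auto simp: E_def C_def)
    show "\<exists>c. P c \<and> infnorm (x - c) \<le> r" if x: "x \<in> E" for x
    proof -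
      obtain g where "x \<in> C g" using x by (auto simp: E_def)
      then have "\<forall>i. c g $ i - r \<le> x $ i \<and> x $ i < c g $ i - r + 2 * r"
        by (simp add: C_def half_open_cube_def a_def)
      then have "infnorm (x - c g) \<le> r"
        unfolding infnorm_vec_le vector_minus_component by (smt (verit))
      then show ?thesis using c(1) by blast
    qed
    have cI: "real (card I) * (2 * r) ^ CARD('k) = v"
      using cardI unfolding vN by (simp add: mult.left_commute)
    show "real (card (a ` I)) * (2 * r) ^ CARD('k) \<le> v"
      unfolding cI[symmetric] using \<open>r > 0\<close> \<open>finite I\<close>
      by (intro mult_right_mono) (auto intro: card_image_le)
    have "measure lborel E = (\<Sum>g\<in>I. measure lborel (C g))"
      unfolding E_def
    proof (intro measure_finite_Union \<open>finite I\<close>)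
      show "disjoint_family_on C I"
        using disjG CG unfolding disjoint_family_on_def by blast
    qed (use \<open>r > 0\<close> in \<open>auto simp: C_def emeasure_half_open_cube\<close>)
    then show "measure lborel E = v" using cI by (simp add: mC)
    fix b \<rho> assume "\<rho> > (0 :: real)"
    define J where "J = {g\<in>I. C g \<inter> half_open_cube b \<rho> \<noteq> {}}"
    have "finite J" using \<open>finite I\<close> by (simp add: J_def)
    have "measure lborel (E \<inter> half_open_cube b \<rho>) \<le> measure lborel (\<Union>g\<in>J. C g)"
      using \<open>finite J\<close> \<open>finite I\<close>
      by (intro measure_mono_fmeasurable) (auto simp: J_def E_def C_def)
    also have "\<dots> \<le> (\<Sum>g\<in>J. measure lborel (C g))"
      using \<open>finite J\<close> by (intro measure_UNION_le) (auto simp: C_def)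
    \<comment> \<open>The small cubes are traded for their cells at the price of the factor
      \<open>v\<close>. These cells all meet the test cube, hence lie in its enlargement by
      \<open>1 / N\<close> on each side.\<close>
    also have "\<dots> = v * measure lborel (\<Union>g\<in>J. G g)"
      unfolding mC unionG[OF \<open>finite J\<close>] vN by simp
    also have "\<dots> \<le> v * measure lborel (half_open_cube (\<chi> i. b $ i - 1 / real N) (\<rho> + 2 / real N))"
    proof (intro mult_left_mono measure_mono_fmeasurable)
      show "(\<Union>g\<in>J. G g) \<subseteq> half_open_cube (\<chi> i. b $ i - 1 / real N) (\<rho> + 2 / real N)"
      proof
        fix x assume "x \<in> (\<Union>g\<in>J. G g)"
        then obtain g y where g: "x \<in> G g" "y \<in> G g" "y \<in> half_open_cube b \<rho>"
          using CG by (fastforce simp: J_def)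
        have "b $ i - 1 / real N \<le> x $ i \<and> x $ i < b $ i - 1 / real N + (\<rho> + 2 / real N)" for i
        proof -
          have "of_int (g i) / real N \<le> x $ i \<and> x $ i < of_int (g i) / real N + 1 / real N"
               "of_int (g i) / real N \<le> y $ i \<and> y $ i < of_int (g i) / real N + 1 / real N"
               "b $ i \<le> y $ i \<and> y $ i < b $ i + \<rho>"
            using g by (simp_all add: G_def half_open_cube_def)
          moreover have "2 / real N = 1 / real N + 1 / real N" by simp
          ultimately show ?thesis by linarith
        qed
        then show "x \<in> half_open_cube (\<chi> i. b $ i - 1 / real N) (\<rho> + 2 / real N)"
          by (simp add: half_open_cube_def)
      qed
      show "(\<Union>g\<in>J. G g) \<in> sets lborel"
        using \<open>finite J\<close> by (auto simp: G_def)
    qed (use \<open>v > 0\<close> in auto)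
    also have "\<dots> = v * (\<rho> + 2 / real N) ^ CARD('k)"
      using \<open>\<rho> > 0\<close> by (simp add: measure_half_open_cube)
    finally show "measure lborel (E \<inter> half_open_cube b \<rho>) \<le> v * (\<rho> + 2 / real N) ^ CARD('k)" .
  qed
qed

text \<open>The local bound for \<open>E'\<close> is applied in each cube of the cover of
  \<open>E\<close>. The excess over independence is governed by \<open>1 / (N' * r)\<close>, the
  mesh of the second grid relative to the cubes of the first.\<close>

lemma measure_Int_le_if_covered_by_cubes:
  fixes E E' :: "(real^'k) set"
  assumes "r > 0" "N' > 0" "v' \<ge> 0" "finite S" "E \<in> sets borel" "E' \<in> sets borel"
    and cover: "E \<subseteq> (\<Union>a\<in>S. half_open_cube a (2 * r))"
    and card: "real (card S) * (2 * r) ^ CARD('k) \<le> v"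
    and loc: "\<And>a. measure lborel (E' \<inter> half_open_cube a (2 * r)) \<le> v' * (2 * r + 2 / N') ^ CARD('k)"
  shows "measure lborel (E \<inter> E') \<le> v * v' * (1 + 1 / (N' * r)) ^ CARD('k)"
proof -
  have fm: "E' \<inter> half_open_cube a (2 * r) \<in> fmeasurable lborel" for a
    using fmeasurable_Int_fmeasurable[OF fmeasurable_half_open_cube, of E' a "2 * r"] assms
    by (simp add: Int_commute)
  have "measure lborel (E \<inter> E') \<le> measure lborel (\<Union>a\<in>S. E' \<inter> half_open_cube a (2 * r))"
    using assms fm by (intro measure_mono_fmeasurable fmeasurable.finite_UN) (auto simp del: sets_lborel)
  also have "\<dots> \<le> (\<Sum>a\<in>S. measure lborel (E' \<inter> half_open_cube a (2 * r)))"
    using \<open>finite S\<close> fmeasurableD[OF fm] by (intro measure_UNION_le) auto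
  also have "\<dots> \<le> (\<Sum>a\<in>S. v' * (2 * r + 2 / N') ^ CARD('k))"
    by (intro sum_mono loc)
  also have "2 * r + 2 / N' = 2 * r * (1 + 1 / (N' * r))"
    using \<open>r > 0\<close> \<open>N' > 0\<close> by (simp add: field_simps)
  also have "(\<Sum>a\<in>S. v' * (2 * r * (1 + 1 / (N' * r))) ^ CARD('k)) =
      real (card S) * (2 * r) ^ CARD('k) * (v' * (1 + 1 / (N' * r)) ^ CARD('k))"
    by (simp add: power_mult_distrib)
  also have "\<dots> \<le> v * (v' * (1 + 1 / (N' * r)) ^ CARD('k))"
    using assms by (intro mult_right_mono card) auto
  finally show ?thesis by (simp add: mult.assoc)
qed

text \<open>Each late stage gets a grid of mesh between \<open>4 * R k\<close> and
  \<open>8 * R k\<close>. The resulting set has measure at least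
  \<open>(r k / (4 * R k)) ^ CARD('k)\<close>, so \<open>div\<close> makes the sum of measures
  diverge; \<open>ratio\<close> makes later grids fine compared with earlier cubes, which gives
  quasi-independence.\<close>

lemma AE_infinitely_often_near_targets:
  fixes P :: "nat \<Rightarrow> real^'k \<Rightarrow> bool" and R r :: "nat \<Rightarrow> real"
  assumes r_pos: "\<And>k. 0 < r k" and r_le: "\<And>k. r k \<le> R k" and "R \<longlonglongrightarrow> 0"
    and near: "\<And>k y. \<exists>c. P k c \<and> infnorm (y - c) \<le> R k"
    and div: "\<not> summable (\<lambda>k. (r k / R k) ^ CARD('k))"
    and ratio: "\<And>e. e > 0 \<Longrightarrow> \<exists>K. \<forall>k\<ge>K. \<forall>j>k. R j \<le> e * r k"
  shows "AE x in lborel. x \<in> half_open_cube 0 1 \<longrightarrow> (\<exists>\<^sub>\<infinity>k. \<exists>c. P k c \<and> infnorm (x - c) \<le> r k)"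
proof -
  let ?m = "CARD('k)"
  have R_pos: "R k > 0" for k using r_pos[of k] r_le[of k] by linarith
  \<comment> \<open>For \<open>R k < 1 / 8\<close> the number \<open>1 / (4 * R k)\<close> exceeds
    2, so rounding it down loses at most a factor 2. The shift by \<open>K0\<close> drops the
    finitely many earlier stages.\<close>
  have "eventually (\<lambda>k. R k < 1 / 8) sequentially"
    using \<open>R \<longlonglongrightarrow> 0\<close> by (rule order_tendstoD) simp
  then obtain K0 where K0: "\<And>k. k \<ge> K0 \<Longrightarrow> R k < 1 / 8"
    by (auto simp: eventually_sequentially)
  \<comment> \<open>As \<open>r \<le> R\<close>, this choice gives
    \<open>R + r \<le> 2 * R \<le> 1 / (2 * N)\<close>, the condition \<open>fit\<close> of the
    grid.\<close>
  define N where "N k = nat \<lfloor>1 / (4 * R (k + K0))\<rfloor>" for k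
  define v where "v k = (2 * r (k + K0) * real (N k)) ^ ?m" for k
  have N: "N k > 0 \<and> 1 / (8 * R (k + K0)) \<le> real (N k) \<and> R (k + K0) + r (k + K0) \<le> 1 / (2 * real (N k))" for k
  proof -
    define t where "t = 1 / (4 * R (k + K0))"
    have "t \<ge> 2" using K0[of "k + K0"] R_pos[of "k + K0"] by (simp add: t_def field_simps)
    then have n: "real (N k) \<le> t" "t - 1 < real (N k)" unfolding N_def t_def[symmetric] by linarith+
    then have "real (N k) > 0" using \<open>t \<ge> 2\<close> by linarith
    moreover have "1 / (8 * R (k + K0)) \<le> real (N k)"
      using n \<open>t \<ge> 2\<close> by (simp add: t_def)
    moreover have "2 * R (k + K0) = 1 / (2 * t)"
      using R_pos[of "k + K0"] by (simp add: t_def)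
    then have "R (k + K0) + r (k + K0) \<le> 1 / (2 * t)" using r_le[of "k + K0"] by linarith
    moreover have "1 / (2 * t) \<le> 1 / (2 * real (N k))"
      using n \<open>real (N k) > 0\<close> by (intro divide_left_mono) auto
    ultimately show ?thesis by auto
  qed
  have "\<exists>E S. E \<in> sets borel \<and> E \<subseteq> half_open_cube 0 1 \<and> finite S \<and>
      (\<forall>x\<in>E. \<exists>c. P (k + K0) c \<and> infnorm (x - c) \<le> r (k + K0)) \<and>
      E \<subseteq> (\<Union>a\<in>S. half_open_cube a (2 * r (k + K0))) \<and>
      real (card S) * (2 * r (k + K0)) ^ ?m \<le> v k \<and> measure lborel E = v k \<and>
      (\<forall>a \<rho>. \<rho> > 0 \<longrightarrow> measure lborel (E \<inter> half_open_cube a \<rho>) \<le> v k * (\<rho> + 2 / real (N k)) ^ ?m)" for k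
  proof (rule exists_grid_of_cubes[of "N k" "r (k + K0)" "R (k + K0)" "P (k + K0)" "v k"])
    show "N k > 0" "R (k + K0) + r (k + K0) \<le> 1 / (2 * real (N k))" using N[of k] by auto
    fix E S
    assume props: "E \<in> sets borel" "E \<subseteq> half_open_cube 0 1" "finite S"
      "\<And>x. x \<in> E \<Longrightarrow> \<exists>c. P (k + K0) c \<and> infnorm (x - c) \<le> r (k + K0)"
      "E \<subseteq> (\<Union>a\<in>S. half_open_cube a (2 * r (k + K0)))"
      "real (card S) * (2 * r (k + K0)) ^ ?m \<le> v k" "measure lborel E = v k"
      "\<And>a \<rho>. \<rho> > 0 \<Longrightarrow> measure lborel (E \<inter> half_open_cube a \<rho>) \<le> v k * (\<rho> + 2 / real (N k)) ^ ?m"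
    show ?thesis
      by (rule exI[of _ E], rule exI[of _ S], intro conjI ballI allI impI) (rule props; assumption)+
  qed (use r_pos near v_def in auto)
  then obtain E S where E_borel: "\<And>k. E k \<in> sets borel" and E_sub: "\<And>k. E k \<subseteq> half_open_cube 0 1"
    and S: "\<And>k. finite (S k)" and E_near: "\<And>k x. x \<in> E k \<Longrightarrow> \<exists>c. P (k + K0) c \<and> infnorm (x - c) \<le> r (k + K0)"
    and E_cover: "\<And>k. E k \<subseteq> (\<Union>a\<in>S k. half_open_cube a (2 * r (k + K0)))"
    and card_S: "\<And>k. real (card (S k)) * (2 * r (k + K0)) ^ ?m \<le> v k"
    and E_measure: "\<And>k. measure lborel (E k) = v k"
    and E_local: "\<And>k a \<rho>. \<rho> > 0 \<Longrightarrow>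
        measure lborel (E k \<inter> half_open_cube a \<rho>) \<le> v k * (\<rho> + 2 / real (N k)) ^ ?m"
    by metis
  define Q where "Q = restrict_space lborel (half_open_cube (0 :: real^'k) 1)"
  interpret Q: prob_space Q
    by (rule prob_spaceI) (simp add: Q_def space_restrict_space emeasure_restrict_space emeasure_half_open_cube)
  have Q_measure: "measure Q B = measure lborel B" if "B \<subseteq> half_open_cube 0 1" for B
    using that by (simp add: Q_def measure_restrict_space)
  have v_pos: "v k > 0" for k using N[of k] r_pos[of "k + K0"] by (simp add: v_def)
  have "AE x in Q. \<exists>\<^sub>\<infinity>k. x \<in> E k"
  proof (rule Q.AE_infinitely_often_if_quasi_independent)
    show "E k \<in> Q.events" for k
      using E_borel E_sub by (auto simp: Q_def sets_restrict_space_iff)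
    show "\<not> summable (\<lambda>k. Q.prob (E k))"
    proof
      assume "summable (\<lambda>k. Q.prob (E k))"
      then have "summable (\<lambda>k. 4 ^ ?m * v k)"
        by (intro summable_mult) (simp add: Q_measure[OF E_sub] E_measure)
      then have "summable (\<lambda>k. (r (k + K0) / R (k + K0)) ^ ?m)"
      proof (rule summable_comparison_test')
        fix k
        have "r (k + K0) / R (k + K0) = 4 * (2 * r (k + K0) * (1 / (8 * R (k + K0))))"
          by simp
        also have "\<dots> \<le> 4 * (2 * r (k + K0) * real (N k))"
          using N[of k] r_pos[of "k + K0"] by (intro mult_left_mono) auto
        finally have "(r (k + K0) / R (k + K0)) ^ ?m \<le> (4 * (2 * r (k + K0) * real (N k))) ^ ?m"
          using r_pos R_pos by (intro power_mono) (auto simp: less_imp_le)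
        also have "\<dots> = 4 ^ ?m * v k"
          unfolding v_def by (rule power_mult_distrib)
        finally show "norm ((r (k + K0) / R (k + K0)) ^ ?m) \<le> 4 ^ ?m * v k"
          using r_pos[of "k + K0"] R_pos[of "k + K0"] by simp
      qed
      then show False using div by (simp add: summable_iff_shift[of "\<lambda>k. (r k / R k) ^ ?m"])
    qed
    fix e :: real assume "e > 0"
    \<comment> \<open>The correlation factor is a power with the dimension as exponent, hence the
      root. The 8 in \<open>\<delta> / 8\<close> below compensates
      \<open>1 / N j \<le> 8 * R (j + K0)\<close>.\<close>
    define \<delta> where "\<delta> = root ?m (1 + e) - 1"
    have "root ?m (1 + e) > root ?m 1" using \<open>e > 0\<close> by (subst real_root_less_iff) auto
    then have "\<delta> > 0" by (simp add: \<delta>_def)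
    have \<delta>_pow: "(1 + \<delta>) ^ ?m = 1 + e" using \<open>e > 0\<close> by (simp add: \<delta>_def)
    obtain K where K: "\<And>k j. k \<ge> K \<Longrightarrow> j > k \<Longrightarrow> R j \<le> (\<delta> / 8) * r k"
      using ratio[of "\<delta> / 8"] \<open>\<delta> > 0\<close> by auto
    have "Q.prob (E k \<inter> E j) \<le> (1 + e) * Q.prob (E k) * Q.prob (E j)" if kj: "k \<ge> K" "j > k" for k j
    proof -
      have "1 / (real (N j) * r (k + K0)) \<le> 8 * R (j + K0) / r (k + K0)"
        using N[of j] r_pos[of "k + K0"] R_pos[of "j + K0"] by (simp add: field_simps)
      also have "\<dots> \<le> \<delta>"
        using K[of "k + K0" "j + K0"] kj r_pos[of "k + K0"] by (simp add: field_simps)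
      finally have *: "(1 + 1 / (real (N j) * r (k + K0))) ^ ?m \<le> 1 + e"
        unfolding \<delta>_pow[symmetric] using r_pos[of "k + K0"] by (intro power_mono) auto
      have "measure lborel (E k \<inter> E j) \<le> v k * v j * (1 + 1 / (real (N j) * r (k + K0))) ^ ?m"
        using N[of j] r_pos[of "k + K0"] v_pos[of j]
        by (intro measure_Int_le_if_covered_by_cubes[OF _ _ _ S E_borel E_borel E_cover card_S E_local]) auto
      also have "\<dots> \<le> v k * v j * (1 + e)"
        using v_pos[of k] v_pos[of j] by (intro mult_left_mono *) auto
      finally show ?thesis
        using E_sub by (simp add: Q_measure[OF E_sub] Q_measure[OF le_infI1[OF E_sub]] E_measure mult_ac)
    qed
    then show "\<exists>K. \<forall>k\<ge>K. \<forall>j>k. Q.prob (E k \<inter> E j) \<le> (1 + e) * Q.prob (E k) * Q.prob (E j)"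
      by blast
  qed
  then have "AE x in Q. \<exists>\<^sub>\<infinity>k. \<exists>c. P k c \<and> infnorm (x - c) \<le> r k"
  proof (rule AE_mp, intro AE_I2 impI)
    fix x assume "\<exists>\<^sub>\<infinity>k. x \<in> E k"
    then show "\<exists>\<^sub>\<infinity>k. \<exists>c. P k c \<and> infnorm (x - c) \<le> r k"
      unfolding INFM_nat_le using E_near by (meson trans_le_add1)
  qed
  then show ?thesis
    unfolding Q_def by (subst (asm) AE_restrict_space_iff) auto
qed


subsection \<open>The discontinuities of \<open>Psi\<close>\<close>

lemma int_dist_le: "p \<in> int_vecs \<Longrightarrow> int_dist z \<le> infnorm (z - p)"
  using int_dist_attained[of z] by auto

lemma int_dist_nonneg: "int_dist z \<ge> 0"
  using int_dist_attained[of z] by (auto simp: infnorm_pos_le)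

lemma int_dist_le_half:
  fixes z :: "real^'k"
  shows "int_dist z \<le> 1 / 2"
proof -
  define p :: "real^'k" where "p = (\<chi> i. of_int (round (z $ i)))"
  have "int_dist z \<le> infnorm (z - p)"
    by (rule int_dist_le) (simp add: p_def int_vecs_def)
  also have "\<dots> \<le> 1 / 2"
    unfolding infnorm_vec_le p_def
    using of_int_round_abs_le[where 'a = real] by (simp add: abs_minus_commute[of "z $ _"])
  finally show ?thesis .
qed

lemma infnorm_int_vec_ge_1:
  fixes q :: "real^'k"
  assumes "q \<in> int_vecs" "q \<noteq> 0"
  shows "infnorm q \<ge> 1"
proof -
  obtain i where "q $ i \<noteq> 0" using assms by (auto simp: vec_eq_iff)
  then have "\<bar>q $ i\<bar> \<ge> 1" using assms by (intro Ints_nonzero_abs_ge1) (auto simp: int_vecs_def)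
  then show ?thesis using component_le_infnorm_cart[of q i] by linarith
qed

lemma int_vecs_diff: "p \<in> int_vecs \<Longrightarrow> q \<in> int_vecs \<Longrightarrow> p - q \<in> int_vecs"
  by (simp add: int_vecs_def)

lemma countable_int_vecs: "countable (int_vecs :: (real^'k) set)"
proof -
  have "(int_vecs :: (real^'k) set) \<subseteq> (\<Union>n::nat. {p. p \<in> int_vecs \<and> infnorm p \<le> real n})"
    using real_arch_simple by blast
  then show ?thesis
    by (rule countable_subset) (simp add: countable_finite[OF finite_int_vecs_le])
qed

lemma Psi_le:
  fixes A :: "real^'n^'m"
  assumes "q \<in> int_vecs" "0 < infnorm q" "infnorm q \<le> t"
  shows "Psi A t \<le> int_dist (A *v q)"
proof -
  have "finite ((\<lambda>q. int_dist (A *v q)) ` {q. q \<in> int_vecs \<and> infnorm q \<le> t})"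
    by (intro finite_imageI finite_int_vecs_le)
  then have "finite {int_dist (A *v q) | q. q \<in> int_vecs \<and> 0 < infnorm q \<and> infnorm q \<le> t}"
    by (rule rev_finite_subset) auto
  then show ?thesis
    unfolding Psi_def using assms by (intro Min_le) auto
qed

lemma Psi_antimono:
  fixes A :: "real^'n^'m"
  assumes "1 \<le> s" "s \<le> t"
  shows "Psi A t \<le> Psi A s"
proof -
  obtain q where "q \<in> int_vecs" "0 < infnorm q" "infnorm q \<le> s" "Psi A s = int_dist (A *v q)"
    using Psi_attained[OF assms(1), of A] by auto
  then show ?thesis using Psi_le[of q t A] assms by auto
qed

lemma Psi_nonneg: "t \<ge> 1 \<Longrightarrow> Psi A t \<ge> 0"
  using Psi_attained[of t A] int_dist_nonneg by metis

lemma discontinuity_seq_ge_1: "discontinuity_seq A M \<Longrightarrow> M l \<ge> 1"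
  unfolding discontinuity_seq_def by blast

lemma discontinuity_seq_less: "discontinuity_seq A M \<Longrightarrow> k < l \<Longrightarrow> M k < M l"
  unfolding discontinuity_seq_def by (simp add: strict_monoD)

text \<open>If some integer vector shorter than \<open>M (l + 1)\<close> beat \<open>zeta\<close>, a
  shortest such vector would make \<open>Psi\<close> jump at its norm, strictly between the
  consecutive discontinuities \<open>M l\<close> and \<open>M (l + 1)\<close>.\<close>

lemma zeta_le_int_dist:
  fixes A :: "real^'n^'m"
  assumes M: "discontinuity_seq A M" and q: "q \<in> int_vecs" "0 < infnorm q" "infnorm q < M (l + 1)"
  shows "zeta A M l \<le> int_dist (A *v q)"
proof (rule ccontr)
  assume "\<not> zeta A M l \<le> int_dist (A *v q)"
  then have less: "int_dist (A *v q) < Psi A (M l)" by (simp add: zeta_def)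
  define Q where "Q = {p. p \<in> int_vecs \<and> 0 < infnorm p \<and> infnorm p \<le> infnorm q \<and> int_dist (A *v p) < Psi A (M l)}"
  have "finite Q"
    by (rule finite_subset[OF _ finite_int_vecs_le[of "infnorm q"]]) (auto simp: Q_def)
  moreover have "q \<in> Q" using q less by (simp add: Q_def)
  ultimately obtain p where p: "p \<in> Q" and p_min: "\<And>p'. p' \<in> Q \<Longrightarrow> infnorm p \<le> infnorm p'"
    using arg_min_if_finite(1)[of Q infnorm] arg_min_least[of Q _ infnorm] by blast
  define s where "s = infnorm p"
  have "M l < s"
    using Psi_le[of p "M l" A] p by (force simp: Q_def s_def)
  have "M l \<ge> 1" by (rule discontinuity_seq_ge_1[OF M])
  have Psi_s: "Psi A s < Psi A (M l)"
    using Psi_le[of p s A] p by (force simp: Q_def s_def)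
  have const: "Psi A u \<ge> Psi A (M l)" if u: "M l \<le> u" "u < s" for u
  proof (rule ccontr)
    assume "\<not> Psi A (M l) \<le> Psi A u"
    moreover obtain p' where "p' \<in> int_vecs" "0 < infnorm p'" "infnorm p' \<le> u" "Psi A u = int_dist (A *v p')"
      using Psi_attained[of u A] u \<open>M l \<ge> 1\<close> by auto
    ultimately have "p' \<in> Q" using u p by (auto simp: Q_def s_def)
    then show False using p_min[of p'] u \<open>infnorm p' \<le> u\<close> by (simp add: s_def)
  qed
  have "s < M (l + 1)" using p q by (auto simp: Q_def s_def)
  have "s \<notin> range M"
  proof
    assume "s \<in> range M"
    then obtain j where "s = M j" by blast
    moreover have "strict_mono M" using M by (simp add: discontinuity_seq_def)
    ultimately have "l < j" "j < l + 1"
      using \<open>M l < s\<close> \<open>s < M (l + 1)\<close> by (simp_all add: strict_mono_less)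
    then show False by simp
  qed
  then have "continuous (at s within {1..}) (Psi A)"
    using M \<open>M l < s\<close> \<open>M l \<ge> 1\<close> by (auto simp: discontinuity_seq_def)
  then obtain e where e: "e > 0" "\<And>u. u \<ge> 1 \<Longrightarrow> dist u s < e \<Longrightarrow> dist (Psi A u) (Psi A s) < Psi A (M l) - Psi A s"
    unfolding continuous_within_eps_delta using Psi_s by (metis atLeast_iff diff_gt_0_iff_gt)
  \<comment> \<open>A point just left of \<open>s\<close>, where \<open>Psi\<close> has not dropped
    yet; continuity at \<open>s\<close> would force its value below
    \<open>Psi A (M l)\<close>.\<close>
  define u where "u = max (M l) (s - e / 2)"
  have "M l \<le> u" "u < s" "dist u s < e"
    using \<open>M l < s\<close> \<open>e > 0\<close> by (auto simp: u_def dist_real_def)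
  then show False
    using e(2)[of u] const[of u] \<open>M l \<ge> 1\<close> by (simp add: dist_real_def)
qed

text \<open>A zero value would persist, as \<open>Psi\<close> is antitone and nonnegative, so
  \<open>Psi\<close> would be locally constant at the next discontinuity.\<close>

lemma zeta_pos:
  fixes A :: "real^'n^'m"
  assumes M: "discontinuity_seq A M"
  shows "zeta A M l > 0"
proof (rule ccontr)
  assume "\<not> zeta A M l > 0"
  have "M l \<ge> 1" by (rule discontinuity_seq_ge_1[OF M])
  then have zero: "Psi A t = 0" if "t \<ge> M l" for t
    using that \<open>\<not> zeta A M l > 0\<close> Psi_antimono[of "M l" t A] Psi_nonneg[of t A] by (simp add: zeta_def)
  have lt: "M l < M (l + 1)" using discontinuity_seq_less[OF M, of l "l + 1"] by simp
  have "continuous (at (M (l + 1)) within {1..}) (Psi A)"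
    unfolding continuous_within_eps_delta
  proof (intro allI impI exI[of _ "M (l + 1) - M l"] conjI ballI)
    fix e u :: real assume "e > 0" "dist u (M (l + 1)) < M (l + 1) - M l"
    then show "dist (Psi A u) (Psi A (M (l + 1))) < e"
      using zero[of u] zero[of "M (l + 1)"] lt by (auto simp: dist_real_def)
  qed (use lt in auto)
  moreover have "M (l + 1) \<in> range M" by blast
  ultimately show False using M by (auto simp: discontinuity_seq_def)
qed

text \<open>This serves the lattice points with \<open>q = 0\<close>: there \<open>p\<close> is a
  nonzero integer vector, whose norm is at least 1 and so exceeds \<open>zeta\<close>.\<close>

lemma zeta_le_half: "discontinuity_seq A M \<Longrightarrow> zeta A M l \<le> 1 / 2"
  using Psi_attained[OF discontinuity_seq_ge_1, of A M l] int_dist_le_half unfolding zeta_def by metis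


subsection \<open>Covering by the orbit, and the null set\<close>

text \<open>The unit cube is a fundamental domain of the integer lattice. This serves both for the
  orbit lattice and for the torus.\<close>

lemma ex1_int_vec_floor:
  fixes z :: "real^'k"
  shows "\<exists>!p. p \<in> int_vecs \<and> z - p \<in> half_open_cube 0 1"
proof -
  have *: "p \<in> int_vecs \<and> z - p \<in> half_open_cube 0 1 \<longleftrightarrow> p = (\<chi> i. of_int \<lfloor>z $ i\<rfloor>)" for p
  proof
    assume p: "p \<in> int_vecs \<and> z - p \<in> half_open_cube 0 1"
    have "p $ i = of_int \<lfloor>z $ i\<rfloor>" for i
    proof -
      obtain a where a: "p $ i = of_int a" using p unfolding int_vecs_def by (blast elim: Ints_cases)
      have "0 \<le> z $ i - p $ i \<and> z $ i - p $ i < 1" using p by (simp add: half_open_cube_def)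
      then have "\<lfloor>z $ i\<rfloor> = a" unfolding a by (intro floor_unique) auto
      then show ?thesis by (simp add: a)
    qed
    then show "p = (\<chi> i. of_int \<lfloor>z $ i\<rfloor>)" by (simp add: vec_eq_iff)
  next
    assume p: "p = (\<chi> i. of_int \<lfloor>z $ i\<rfloor>)"
    show "p \<in> int_vecs \<and> z - p \<in> half_open_cube 0 1"
      unfolding p by (auto simp: int_vecs_def half_open_cube_def) linarith
  qed
  show ?thesis unfolding * by simp
qed

text \<open>Scaling the first \<open>m\<close> coordinates by \<open>1 / zeta\<close> and the last
  \<open>n\<close> by \<open>1 / M (l + 1)\<close> turns the box without nonzero lattice points into
  the open unit ball of \<open>infnorm\<close>, and the covolume into \<open>1 / Delta\<close>. Then
  \<open>covering_radius_less\<close> bounds the covering radius by \<open>1 / Delta\<close> and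
  gives \<open>1 \<le> 1 / Delta\<close>; scaling back yields the claims.\<close>

lemma covering_by_orbit:
  fixes A :: "real^'n^'m"
  assumes M: "discontinuity_seq A M"
  shows "0 < Delta A M l" and "Delta A M l \<le> 1"
    and "\<exists>q\<in>int_vecs. \<exists>p\<in>int_vecs. infnorm q \<le> M (l + 1) / Delta A M l \<and>
           infnorm (y - (A *v q - p)) \<le> zeta A M l / Delta A M l"
proof -
  define z where "z = zeta A M l"
  define T where "T = M (l + 1)"
  have "z > 0" "z \<le> 1 / 2" using zeta_pos[OF M] zeta_le_half[OF M] by (auto simp: z_def)
  have "T \<ge> 1" using discontinuity_seq_ge_1[OF M] by (simp add: T_def)
  have Delta: "Delta A M l = T ^ CARD('n) * z ^ CARD('m)" by (simp add: Delta_def z_def T_def)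
  show pos: "0 < Delta A M l" unfolding Delta using \<open>z > 0\<close> \<open>T \<ge> 1\<close> by simp
  define pt where "pt p q = ((1 / z) *\<^sub>R (A *v q - p), (1 / T) *\<^sub>R q)" for p q
  define L where "L = (\<lambda>(p, q). pt p q) ` (int_vecs \<times> int_vecs)"
  define D where "D = half_open_cube (0 :: real^'m) (1 / z) \<times> half_open_cube (0 :: real^'n) (1 / T)"
  have cube_scale: "x - (1 / c) *\<^sub>R w \<in> half_open_cube 0 (1 / c) \<longleftrightarrow> c *\<^sub>R x - w \<in> half_open_cube 0 1"
    if "c > 0" for c and x w :: "real^'k"
  proof -
    have "x $ i - w $ i / c = (c * x $ i - w $ i) / c" for i
      using that by (simp add: field_simps)
    then show ?thesis
      using that by (simp add: half_open_cube_def divide_less_cancel zero_le_divide_iff)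
  qed
  have "countable L"
    unfolding L_def by (intro countable_image countable_SIGMA countable_int_vecs)
  have pt_in_L: "pt p q \<in> L" if "p \<in> int_vecs" "q \<in> int_vecs" for p q
    unfolding L_def by (rule image_eqI[of _ _ "(p, q)"]) (use that in auto)
  have "0 \<in> L"
    using pt_in_L[of 0 0] by (simp add: pt_def int_vecs_def zero_prod_def)
  have L_diff: "u - v \<in> L" if "u \<in> L" "v \<in> L" for u v
  proof -
    obtain p q p' q' where *: "u = pt p q" "v = pt p' q'"
      "p \<in> int_vecs" "q \<in> int_vecs" "p' \<in> int_vecs" "q' \<in> int_vecs"
      using \<open>u \<in> L\<close> \<open>v \<in> L\<close> unfolding L_def by auto
    then have "u - v = pt (p - p') (q - q')"
      by (simp add: pt_def algebra_simps matrix_vector_mult_diff_distrib)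
    then show ?thesis using * by (auto intro: pt_in_L int_vecs_diff)
  qed
  have D_borel: "D \<in> sets borel"
    unfolding D_def by (intro borel_Times) auto
  have "emeasure lborel D = emeasure (lborel \<Otimes>\<^sub>M lborel) D" by (simp add: lborel_prod)
  also have "\<dots> = ennreal ((1 / z) ^ CARD('m)) * ennreal ((1 / T) ^ CARD('n))"
    unfolding D_def using \<open>z > 0\<close> \<open>T \<ge> 1\<close>
    by (subst lborel.emeasure_pair_measure_Times) (auto simp: emeasure_half_open_cube)
  also have "\<dots> = ennreal (1 / Delta A M l)"
    using \<open>z > 0\<close> \<open>T \<ge> 1\<close> unfolding Delta
    by (subst ennreal_mult[symmetric]) (auto simp: power_divide mult.commute)
  finally have D_measure: "emeasure lborel D = ennreal (1 / Delta A M l)" .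
  \<comment> \<open>The lattice basis is triangular: \<open>b\<close> determines \<open>q\<close>,
    then \<open>a\<close> and \<open>q\<close> determine \<open>p\<close>, so the product of cubes
    is a fundamental domain. Writing \<open>- (- p)\<close> matches the form of
    \<open>ex1_int_vec_floor\<close>.\<close>
  have D_iff: "(a, b) - pt p q \<in> D \<longleftrightarrow>
      T *\<^sub>R b - q \<in> half_open_cube 0 1 \<and> (z *\<^sub>R a - A *v q) - (- p) \<in> half_open_cube 0 1" for a b p q
    using cube_scale[of z a "A *v q - p"] cube_scale[of T b q] \<open>z > 0\<close> \<open>T \<ge> 1\<close>
    by (auto simp: D_def pt_def algebra_simps)
  have ex1: "\<exists>!v. v \<in> L \<and> x - v \<in> D" for x
  proof -
    obtain a b where x: "x = (a, b)" by fastforce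
    obtain q where q: "q \<in> int_vecs" "T *\<^sub>R b - q \<in> half_open_cube 0 1"
      and q_unique: "\<And>q'. q' \<in> int_vecs \<Longrightarrow> T *\<^sub>R b - q' \<in> half_open_cube 0 1 \<Longrightarrow> q' = q"
      using ex1_int_vec_floor[of "T *\<^sub>R b"] by blast
    have neg_int: "- p \<in> int_vecs \<longleftrightarrow> p \<in> int_vecs" for p :: "real^'m"
      by (simp add: int_vecs_def)
    obtain p where p: "p \<in> int_vecs" "(z *\<^sub>R a - A *v q) - (- p) \<in> half_open_cube 0 1"
      and p_unique: "\<And>p'. p' \<in> int_vecs \<Longrightarrow> (z *\<^sub>R a - A *v q) - (- p') \<in> half_open_cube 0 1 \<Longrightarrow> p' = p"
      using ex1_int_vec_floor[of "z *\<^sub>R a - A *v q"] by (metis minus_minus neg_int)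
    show ?thesis
    proof (rule ex1I[of _ "pt p q"])
      show "pt p q \<in> L \<and> x - pt p q \<in> D"
        unfolding x D_iff using p q by (auto intro: pt_in_L)
      fix v assume v: "v \<in> L \<and> x - v \<in> D"
      then obtain p' q' where "v = pt p' q'" "p' \<in> int_vecs" "q' \<in> int_vecs" unfolding L_def by auto
      then show "v = pt p q" using v q_unique p_unique unfolding x by (metis D_iff)
    qed
  qed
  have sep: "infnorm v \<ge> 1" if "v \<in> L" "v \<noteq> 0" for v
  proof (rule ccontr)
    assume "\<not> infnorm v \<ge> 1"
    obtain p q where pq: "v = pt p q" "p \<in> int_vecs" "q \<in> int_vecs"
      using \<open>v \<in> L\<close> unfolding L_def by auto
    have less: "infnorm (A *v q - p) < z" "infnorm q < T"
      using \<open>\<not> infnorm v \<ge> 1\<close> \<open>z > 0\<close> \<open>T \<ge> 1\<close>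
      unfolding pq(1) pt_def infnorm_Pair infnorm_mul by (simp_all add: not_le divide_less_eq)
    show False
    proof (cases "q = 0")
      case True
      then have "p \<noteq> 0" using \<open>v \<noteq> 0\<close> pq by (auto simp: pt_def zero_prod_def)
      then have "infnorm p \<ge> 1" using pq by (intro infnorm_int_vec_ge_1)
      then show False using less True \<open>z \<le> 1 / 2\<close> by (simp add: infnorm_neg)
    next
      case False
      then have "z \<le> int_dist (A *v q)"
        unfolding z_def using pq less by (intro zeta_le_int_dist[OF M]) (auto simp: infnorm_pos_lt T_def)
      also have "\<dots> \<le> infnorm (A *v q - p)" using pq by (intro int_dist_le)
      finally show False using less by simp
    qed
  qed
  note cover = covering_radius_less[OF \<open>countable L\<close> \<open>0 \<in> L\<close> L_diff D_borel D_measure ex1 sep]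
  show "Delta A M l \<le> 1" using cover(2) pos by (simp add: field_simps)
  \<comment> \<open>The second component of the target is 0, so that the second component of the
    difference bounds \<open>q\<close> itself.\<close>
  obtain p q where pq: "p \<in> int_vecs" "q \<in> int_vecs"
      "infnorm (((1 / z) *\<^sub>R y, 0) - pt p q) < 1 / Delta A M l"
    using cover(1)[of "((1 / z) *\<^sub>R y, 0)"] unfolding L_def by auto
  have "((1 / z) *\<^sub>R y, 0) - pt p q = ((1 / z) *\<^sub>R (y - (A *v q - p)), (1 / T) *\<^sub>R (- q))"
    by (simp add: pt_def algebra_simps)
  then have "infnorm (y - (A *v q - p)) / z < 1 / Delta A M l" "infnorm q / T < 1 / Delta A M l"
    using pq(3) \<open>z > 0\<close> \<open>T \<ge> 1\<close> by (simp_all add: infnorm_Pair infnorm_mul infnorm_neg)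
  then have "infnorm (y - (A *v q - p)) \<le> z / Delta A M l" "infnorm q \<le> T / Delta A M l"
    using pos \<open>z > 0\<close> \<open>T \<ge> 1\<close> by (simp_all add: field_simps)
  then show "\<exists>q\<in>int_vecs. \<exists>p\<in>int_vecs. infnorm q \<le> M (l + 1) / Delta A M l \<and>
           infnorm (y - (A *v q - p)) \<le> zeta A M l / Delta A M l"
    using pq(1,2) unfolding z_def T_def by blast
qed

section \<open>From good approximations to a null set on the torus\<close>

lemma not_in_Bad_if_arbitrarily_small:
  fixes A :: "real^'n^'m"
  assumes "\<And>c T. c > 0 \<Longrightarrow> \<exists>q\<in>int_vecs. infnorm q \<ge> T \<and>
      infnorm q powr (real CARD('n) / real CARD('m)) * int_dist (A *v q - x) \<le> c"
  shows "torus_of x \<notin> Bad A"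
proof
  assume "torus_of x \<in> Bad A"
  \<comment> \<open>A real \<open>c\<close> below the lower limit exists even if that limit is
    infinite.\<close>
  then obtain c where c: "0 < ereal c" "ereal c < Liminf (inf (filtercomap infnorm at_top) (principal int_vecs))
     (\<lambda>q. ereal (infnorm q powr (real CARD('n) / real CARD('m)) * int_dist (A *v q - x)))"
    unfolding Bad_def mem_Collect_eq torus_dist.abs_eq using ereal_dense2 by blast
  obtain T where "\<And>q. q \<in> int_vecs \<Longrightarrow> infnorm q \<ge> T \<Longrightarrow>
      c < infnorm q powr (real CARD('n) / real CARD('m)) * int_dist (A *v q - x)"
    using less_LiminfD[OF c(2)]
    by (auto simp: eventually_inf_principal eventually_filtercomap_at_top_linorder)
  then show False using assms[of c T] c(1) by force
qed

text \<open>Measurability on the torus refers to the full preimage in \<open>real^'m\<close>, which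
  is covered by countably many integer translates of its part in the unit cube. A null part there
  thus yields measurability and measure 0 together.\<close>

lemma Bad_null_if_null_in_cube:
  fixes A :: "real^'n^'m"
  assumes "AE x in lborel. x \<in> half_open_cube 0 1 \<longrightarrow> torus_of x \<notin> Bad A"
  shows "Bad A \<in> null_sets torus_lebesgue"
proof -
  define B where "B = {x \<in> half_open_cube 0 1. torus_of x \<in> Bad A}"
  obtain N where N: "{x \<in> space lborel. \<not> (x \<in> half_open_cube 0 1 \<longrightarrow> torus_of x \<notin> Bad A)} \<subseteq> N"
      "emeasure lborel N = 0" "N \<in> sets lborel"
    by (rule AE_E[OF assms])
  then have "N \<in> null_sets lebesgue"
    by (intro null_sets_completionI null_setsI)
  moreover have "B \<subseteq> N" using N(1) by (auto simp: B_def)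
  \<comment> \<open>\<open>B\<close> is only known to lie inside the Borel null set
    \<open>N\<close>, so completeness of \<open>lebesgue\<close> is used.\<close>
  ultimately have "B \<in> null_sets lebesgue"
    by (rule null_sets_completion_subset[rotated])
  then have "negligible B" by (simp add: negligible_iff_null_sets)
  have "torus_of -` Bad A \<subseteq> (\<Union>p\<in>int_vecs. (+) p ` B)"
  proof
    fix x assume x: "x \<in> torus_of -` Bad A"
    obtain p where p: "p \<in> int_vecs" "x - p \<in> half_open_cube 0 1"
      using ex1_int_vec_floor[of x] by blast
    have "torus_of (x - p) = torus_of x"
      using p by (intro torus.abs_eq_iff[THEN iffD2]) (auto simp: int_vecs_def)
    then have "x - p \<in> B" using p x by (simp add: B_def)
    then show "x \<in> (\<Union>p\<in>int_vecs. (+) p ` B)"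
      using p(1) by (auto intro!: bexI[of _ p] image_eqI[of _ _ "x - p"])
  qed
  moreover have "negligible (\<Union>p\<in>int_vecs. (+) p ` B)"
    using \<open>negligible B\<close> countable_int_vecs
    by (intro negligible_countable_Union countable_image) (auto intro: negligible_translation)
  ultimately have "negligible (torus_of -` Bad A)" by (rule negligible_subset[rotated])
  then have null: "torus_of -` Bad A \<in> null_sets lebesgue"
    by (simp add: negligible_iff_null_sets)
  then have sets: "Bad A \<in> sets torus_lebesgue"
    by (auto simp: sets_torus_lebesgue)
  have "emeasure torus_lebesgue (Bad A) \<le> emeasure lebesgue (torus_of -` Bad A)"
    unfolding emeasure_torus_lebesgue[OF sets] using null by (intro emeasure_mono) auto
  also have "\<dots> = 0" using null by auto
  finally show ?thesis using sets by (intro null_setsI) auto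
qed

section \<open>Radii for matrices of the class, and the conclusion\<close>

theorem theorem8p4:
  fixes A :: "real^'n^'m"
  assumes "A \<in> class_C"
  shows "Bad A \<in> null_sets torus_lebesgue"
proof -
  let ?m = "CARD('m)" and ?n = "CARD('n)"
  obtain M l where M: "discontinuity_seq A M"
    and sum: "(\<Sum>k. ennreal (Delta A M (l k) ^ (?m + ?n - 1))) = \<infinity>"
    and H: "H_sup A M l \<longlonglongrightarrow> 0"
    using assms by (auto simp: class_C_def)
  define D where "D k = Delta A M (l k)" for k
  define R where "R k = zeta A M (l k) / D k" for k
  define X where "X k = M (l k + 1) / D k" for k
  have D: "0 < D k" "D k \<le> 1" for k using covering_by_orbit[OF M] by (simp_all add: D_def)
  have R_pos: "R k > 0" for k using zeta_pos[OF M] D by (simp add: R_def)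
  have X_ge: "X k \<ge> 1" for k
    using discontinuity_seq_ge_1[OF M, of "l k + 1"] D[of k] by (simp add: X_def field_simps)
  \<comment> \<open>The numerators multiply to \<open>Delta\<close> and the denominators to
    \<open>Delta ^ (m + n)\<close>; this is where the exponent \<open>m + n - 1\<close> of the
    divergence condition comes from.\<close>
  have RX: "R k ^ ?m * X k ^ ?n = 1 / D k ^ (?m + ?n - 1)" for k
  proof -
    have "R k ^ ?m * X k ^ ?n = D k / D k ^ (?m + ?n)"
      by (simp add: R_def X_def power_divide power_add, simp add: D_def Delta_def)
    also have "?m + ?n = Suc (?m + ?n - 1)" by simp
    finally show ?thesis using D[of k] by (simp only: power_Suc) simp
  qed
  have H_small: "\<exists>K. \<forall>k\<ge>K. \<forall>j>k. R j ^ ?m * X k ^ ?n \<le> c" if "c > 0" for c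
  proof -
    have "eventually (\<lambda>k. H_sup A M l k < ereal c) sequentially"
      using H that by (intro order_tendstoD) auto
    then obtain K where K: "\<And>k. k \<ge> K \<Longrightarrow> H_sup A M l k < ereal c"
      by (auto simp: eventually_sequentially)
    have "R j ^ ?m * X k ^ ?n \<le> c" if "k \<ge> K" "j > k" for k j
    proof -
      have "ereal (R j ^ ?m * X k ^ ?n) \<le> H_sup A M l k"
        unfolding H_sup_def R_def X_def D_def using \<open>j > k\<close> by (intro SUP_upper2[of j]) auto
      then show ?thesis using K[OF \<open>k \<ge> K\<close>] by (metis ereal_less_eq(3) less_imp_le order_trans)
    qed
    then show ?thesis by blast
  qed
  \<comment> \<open>At one fixed stage \<open>K\<close> one has \<open>X K \<ge> 1\<close>, so the
    bound on \<open>R j ^ m * X K ^ n\<close> already bounds \<open>R j ^ m\<close>.\<close>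
  have "R \<longlonglongrightarrow> 0"
  proof (rule LIMSEQ_I)
    fix c :: real assume "c > 0"
    then obtain K where K: "\<And>k j. k \<ge> K \<Longrightarrow> j > k \<Longrightarrow> R j ^ ?m * X k ^ ?n \<le> (c / 2) ^ ?m"
      using H_small[of "(c / 2) ^ ?m"] by auto
    have "R j < c" if "j \<ge> Suc K" for j
    proof -
      have "R j ^ ?m \<le> R j ^ ?m * X K ^ ?n"
        using R_pos[of j] X_ge[of K] by (simp add: one_le_power)
      also have "\<dots> \<le> (c / 2) ^ ?m" using that by (intro K) auto
      finally have "R j \<le> c / 2"
        using R_pos[of j] \<open>c > 0\<close> by (subst (asm) power_mono_iff) auto
      then show ?thesis using \<open>c > 0\<close> by simp
    qed
    then show "\<exists>no. \<forall>n\<ge>no. norm (R n - 0) < c" using R_pos by (auto simp: less_imp_le intro!: exI[of _ "Suc K"])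
  qed
  \<comment> \<open>Here \<open>1 / Suc i\<close> plays the role of \<open>\<epsilon>\<close>.
    Countably many values suffice, so that almost every \<open>x\<close> works for all of them
    simultaneously.\<close>
  define r where "r i k = root ?m (1 / real (Suc i) / X k ^ ?n)" for i k
  have r_pos: "r i k > 0" for i k
    unfolding r_def using X_ge[of k] by (intro real_root_gt_zero) auto
  have r_pow: "r i k ^ ?m = 1 / real (Suc i) / X k ^ ?n" for i k
    unfolding r_def using X_ge[of k] by (intro real_root_pow_pos2) auto
  have r_R: "(r i k / R k) ^ ?m = 1 / real (Suc i) * D k ^ (?m + ?n - 1)" for i k
  proof -
    have "(r i k / R k) ^ ?m = 1 / real (Suc i) / (R k ^ ?m * X k ^ ?n)"
      by (simp add: power_divide r_pow)
    then show ?thesis by (simp add: RX)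
  qed
  have r_le: "r i k \<le> R k" for i k
  proof -
    have "1 / real (Suc i) * D k ^ (?m + ?n - 1) \<le> 1 * 1"
      using D[of k] by (intro mult_mono power_le_one) auto
    then have "(r i k / R k) ^ ?m \<le> 1 ^ ?m" unfolding r_R by simp
    then have "r i k / R k \<le> 1"
      using r_pos[of i k] R_pos[of k] by (subst (asm) power_mono_iff) auto
    then show ?thesis using R_pos[of k] by (simp add: field_simps)
  qed
  define P where "P k c \<longleftrightarrow> (\<exists>q\<in>int_vecs. \<exists>p\<in>int_vecs. infnorm q \<le> X k \<and> c = A *v q - p)" for k c
  have AE_i: "AE x in lborel. x \<in> half_open_cube 0 1 \<longrightarrow> (\<exists>\<^sub>\<infinity>k. \<exists>c. P k c \<and> infnorm (x - c) \<le> r i k)" for i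
  proof (rule AE_infinitely_often_near_targets)
    show "R \<longlonglongrightarrow> 0" by fact
    show "\<exists>c. P k c \<and> infnorm (y - c) \<le> R k" for k y
      using covering_by_orbit(3)[OF M, of "l k" y] unfolding P_def R_def X_def D_def by blast
    show "\<not> summable (\<lambda>k. (r i k / R k) ^ ?m)"
    proof
      assume "summable (\<lambda>k. (r i k / R k) ^ ?m)"
      then have "summable (\<lambda>k. D k ^ (?m + ?n - 1))"
        unfolding r_R by (simp add: summable_cmult_iff)
      then have "(\<Sum>k. ennreal (D k ^ (?m + ?n - 1))) \<noteq> \<infinity>"
        using D by (subst suminf_ennreal2) (auto simp: less_imp_le)
      then show False using sum by (simp add: D_def)
    qed
    fix e :: real assume "e > 0"
    \<comment> \<open>Dividing this bound by \<open>X k ^ n\<close> produces exactly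
      \<open>(e * r i k) ^ m\<close>.\<close>
    then obtain K where K: "\<And>k j. k \<ge> K \<Longrightarrow> j > k \<Longrightarrow> R j ^ ?m * X k ^ ?n \<le> e ^ ?m / real (Suc i)"
      using H_small[of "e ^ ?m / real (Suc i)"] by auto
    have "R j \<le> e * r i k" if "k \<ge> K" "j > k" for k j
    proof -
      have "0 < X k ^ ?n" using X_ge[of k] by auto
      then have "R j ^ ?m \<le> e ^ ?m / real (Suc i) / X k ^ ?n"
        using K[OF that] by (subst pos_le_divide_eq)
      also have "\<dots> = (e * r i k) ^ ?m" by (simp add: power_mult_distrib r_pow)
      finally show ?thesis
        using \<open>e > 0\<close> r_pos[of i k] R_pos[of j] by (subst (asm) power_mono_iff) auto
    qed
    then show "\<exists>K. \<forall>k\<ge>K. \<forall>j>k. R j \<le> e * r i k" by blast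
  qed (use r_pos r_le in auto)
  \<comment> \<open>Off this countable set every \<open>A *v q\<close> has positive distance to
    \<open>x\<close> modulo integers; this is what later forces good approximations to use long
    \<open>q\<close>.\<close>
  define orbit where "orbit = (\<lambda>(q, p). A *v q - p) ` (int_vecs \<times> int_vecs)"
  have "countable orbit"
    unfolding orbit_def by (intro countable_image countable_SIGMA countable_int_vecs)
  then have "AE x in lborel. x \<notin> orbit"
    by (intro AE_not_in countable_imp_null_set_lborel)
  moreover have "AE x in lborel. \<forall>i. x \<in> half_open_cube 0 1 \<longrightarrow> (\<exists>\<^sub>\<infinity>k. \<exists>c. P k c \<and> infnorm (x - c) \<le> r i k)"
    unfolding AE_all_countable using AE_i by blast
  ultimately have "AE x in lborel. x \<in> half_open_cube 0 1 \<longrightarrow> torus_of x \<notin> Bad A"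
  proof eventually_elim
    case (elim x)
    show ?case
    proof (intro impI not_in_Bad_if_arbitrarily_small)
      fix c T :: real assume x: "x \<in> half_open_cube 0 1" and "c > 0"
      \<comment> \<open>The product \<open>X k powr (n / m) * r i k\<close> is the
        \<open>m\<close>-th root of \<open>1 / Suc i\<close>, which this choice makes smaller than
        \<open>c\<close>.\<close>
      obtain i where i: "1 / real (Suc i) < c ^ ?m"
        using reals_Archimedean[of "c ^ ?m"] \<open>c > 0\<close> by (auto simp: inverse_eq_divide)
      \<comment> \<open>These are the distances realised by the finitely many \<open>q\<close> of
        norm at most \<open>T\<close>, with 1 inserted to make the set nonempty. Once
        \<open>R k < Min F\<close>, a distance of at most \<open>r i k \<le> R k\<close> needs a
        longer \<open>q\<close>.\<close>
      define F where "F = insert (1 :: real) ((\<lambda>q. int_dist (A *v q - x)) ` {q. q \<in> int_vecs \<and> infnorm q \<le> T})"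
      have "finite F" unfolding F_def using finite_int_vecs_le by auto
      have F_pos: "a > 0" if a: "a \<in> F" for a
      proof (rule ccontr)
        assume "\<not> a > 0"
        then obtain q where q: "q \<in> int_vecs" "int_dist (A *v q - x) \<le> 0" using a by (auto simp: F_def)
        obtain p where p: "p \<in> int_vecs" "int_dist (A *v q - x) = infnorm (A *v q - x - p)"
          using int_dist_attained[of "A *v q - x"] by blast
        then have "infnorm (A *v q - x - p) = 0"
          using q infnorm_pos_le[of "A *v q - x - p"] by simp
        then have "x = A *v q - p" by (simp add: infnorm_eq_0 algebra_simps)
        then show False using elim(1) p q by (auto simp: orbit_def)
      qed
      have "Min F > 0" using \<open>finite F\<close> F_pos by (subst Min_gr_iff) (auto simp: F_def)
      then have "eventually (\<lambda>k. R k < Min F) sequentially"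
        using \<open>R \<longlonglongrightarrow> 0\<close> by (intro order_tendstoD)
      then obtain K where K: "\<And>k. k \<ge> K \<Longrightarrow> R k < Min F"
        by (auto simp: eventually_sequentially)
      obtain k c' where k: "k \<ge> K" "P k c'" "infnorm (x - c') \<le> r i k"
        using elim(2) x unfolding INFM_nat_le by blast
      then obtain q p where qp: "q \<in> int_vecs" "p \<in> int_vecs" "infnorm q \<le> X k" "c' = A *v q - p"
        unfolding P_def by blast
      have "int_dist (A *v q - x) \<le> infnorm (A *v q - x - p)"
        using qp by (intro int_dist_le)
      also have "\<dots> = infnorm (x - c')"
        unfolding qp by (subst infnorm_neg[symmetric]) (simp add: algebra_simps)
      finally have dist: "int_dist (A *v q - x) \<le> r i k" using k(3) by simp
      have "T \<le> infnorm q"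
      proof (rule ccontr)
        assume "\<not> T \<le> infnorm q"
        then have "int_dist (A *v q - x) \<in> F" using qp by (auto simp: F_def)
        then have "Min F \<le> int_dist (A *v q - x)" using \<open>finite F\<close> by simp
        then show False using dist r_le[of i k] K[OF k(1)] by linarith
      qed
      have "(X k powr (real ?n / real ?m)) ^ ?m = X k ^ ?n"
        using X_ge[of k] by (simp add: powr_powr powr_realpow flip: powr_realpow)
      then have "(X k powr (real ?n / real ?m) * r i k) ^ ?m = 1 / real (Suc i)"
        using X_ge[of k] by (simp add: power_mult_distrib r_pow)
      then have "(X k powr (real ?n / real ?m) * r i k) ^ ?m \<le> c ^ ?m"
        using i by simp
      then have "X k powr (real ?n / real ?m) * r i k \<le> c"
        using r_pos[of i k] \<open>c > 0\<close> by (subst (asm) power_mono_iff) auto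
      moreover have "infnorm q powr (real ?n / real ?m) * int_dist (A *v q - x) \<le>
          X k powr (real ?n / real ?m) * r i k"
        using qp dist int_dist_nonneg by (intro mult_mono powr_mono2) (auto simp: infnorm_pos_le)
      ultimately show "\<exists>q\<in>int_vecs. T \<le> infnorm q \<and>
          infnorm q powr (real ?n / real ?m) * int_dist (A *v q - x) \<le> c"
        using qp \<open>T \<le> infnorm q\<close> by fastforce
    qed
  qed
  then show ?thesis by (rule Bad_null_if_null_in_cube)
qed

end
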